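(* Let $N\ge5$ and $p>\frac{N}{N-4}$. Let $Z$ be a compact proper subset of the hyperplane $\{x_1=0\}\subset\mathbb{R}^N$ such that either $\overline{\dim}_M(Z)<N-\frac{4p}{p-1}$, or $Z$ is a smooth $k$-dimensional closed manifold with $k\le N-\frac{4p}{p-1}$. Let $u\in C^4(\mathbb{R}^N\setminus Z)$ be a positive punctured solution of $\Delta^2u=u^p$ in $\mathbb{R}^N\setminus Z$. Then $u\in L^p_{loc}(\mathbb{R}^N)$ and $u$ is a distributional solution in $\mathbb{R}^N$, that is, $$\int_{\mathbb{R}^N}u\,\Delta^2\varphi\,dx=\int_{\mathbb{R}^N}u^p\varphi\,dx\qquad\forall\varphi\in C_c^\infty(\mathbb{R}^N).$$
   Context: Punctured solution: $u\in C^4(\mathbb{R}^N\setminus Z)$ satisfying the equation pointwise in the classical sense in $\mathbb{R}^N\setminus Z$. Upper Minkowski dimension: for a compact set $E\subset\mathbb{R}^N$, the $\lambda$-dimensional Minkowski $r$-content is $\mathcal{M}^\lambda_r(E)=\inf_{l\ge1}\{l\,r^\lambda:\ E\subset\bigcup_{k=1}^lB(x_k,r),\ x_k\in E\}$, and $\overline{\dim}_M(E)=\inf\{\lambda\ge0:\ \limsup_{r\to0}\mathcal{M}^\lambda_r(E)=0\}$. *)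

theory Defs
  imports "HOL-Analysis.Analysis"
begin

text \<open>Throughout, these differentiability notions are only used on open sets.\<close>

primrec Ck_on ::
  "nat \<Rightarrow> 'a::real_normed_vector set \<Rightarrow> ('a \<Rightarrow> 'b::real_normed_vector) \<Rightarrow> bool" where
  "Ck_on 0 S f \<longleftrightarrow> continuous_on S f"
| "Ck_on (Suc k) S f \<longleftrightarrow>
     (\<forall>x\<in>S. f differentiable (at x)) \<and> (\<forall>v. Ck_on k S (\<lambda>x. frechet_derivative f (at x) v))"

definition Cinfty_on ::
  "'a::real_normed_vector set \<Rightarrow> ('a \<Rightarrow> 'b::real_normed_vector) \<Rightarrow> bool" where
  "Cinfty_on S f \<longleftrightarrow> (\<forall>k. Ck_on k S f)"

definition partial_deriv :: "'n::finite \<Rightarrow> (real ^ 'n \<Rightarrow> real) \<Rightarrow> real ^ 'n \<Rightarrow> real" where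
  "partial_deriv i f x = frechet_derivative f (at x) (axis i 1)"

definition laplacian :: "(real ^ 'n::finite \<Rightarrow> real) \<Rightarrow> real ^ 'n \<Rightarrow> real" where
  "laplacian f x = (\<Sum>i\<in>UNIV. partial_deriv i (partial_deriv i f) x)"

definition bilaplacian :: "(real ^ 'n::finite \<Rightarrow> real) \<Rightarrow> real ^ 'n \<Rightarrow> real" where
  "bilaplacian f = laplacian (laplacian f)"

text \<open>Functions on the complement of \<open>Z\<close> are represented by total functions; their values
  on \<open>Z\<close> are arbitrary.\<close>

definition punctured_solution ::
  "real \<Rightarrow> (real ^ 'n::finite) set \<Rightarrow> (real ^ 'n \<Rightarrow> real) \<Rightarrow> bool" where
  "punctured_solution p Z u \<longleftrightarrow>
     Ck_on 4 (- Z) u \<and> (\<forall>x\<in>- Z. bilaplacian u x = u x powr p)"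

text \<open>Extended reals are used so that the infimum over an empty family of coverings (or of
  exponents) is \<open>\<infinity>\<close>.\<close>

definition minkowski_content :: "real \<Rightarrow> real \<Rightarrow> 'a::metric_space set \<Rightarrow> ereal" where
  "minkowski_content d r E =
     Inf {ereal (real l * r powr d) | (l::nat) (x :: nat \<Rightarrow> 'a).
            1 \<le> l \<and> (\<forall>k\<in>{1..l}. x k \<in> E) \<and> E \<subseteq> (\<Union>k\<in>{1..l}. ball (x k) r)}"

definition upper_minkowski_dim :: "'a::metric_space set \<Rightarrow> ereal" where
  "upper_minkowski_dim E =
     Inf {ereal d | d. 0 \<le> d \<and> Limsup (at_right 0) (\<lambda>r. minkowski_content d r E) = 0}"

text \<open>Compact embedded submanifold without boundary, via slice charts: near each of its points,
  a smooth diffeomorphism of open sets of the ambient space flattens \<open>M\<close> onto a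
  \<open>k\<close>-dimensional coordinate subspace. Connectedness is not required, and the empty set
  qualifies for every \<open>k\<close>.\<close>

definition smooth_closed_manifold :: "nat \<Rightarrow> (real ^ 'n::finite) set \<Rightarrow> bool" where
  "smooth_closed_manifold k M \<longleftrightarrow> compact M \<and>
     (\<forall>z\<in>M. \<exists>U V \<Phi> \<Psi> (I :: 'n set).
        open U \<and> open V \<and> z \<in> U \<and> homeomorphism U V \<Phi> \<Psi> \<and>
        Cinfty_on U (\<Phi> :: real ^ 'n \<Rightarrow> real ^ 'n) \<and> Cinfty_on V \<Psi> \<and>
        card I = k \<and> \<Phi> ` (U \<inter> M) = V \<inter> {y. \<forall>i. i \<notin> I \<longrightarrow> y $ i = 0})"

definition Lp_loc :: "real \<Rightarrow> ('a::euclidean_space \<Rightarrow> real) \<Rightarrow> bool" where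
  "Lp_loc p f \<longleftrightarrow> f \<in> borel_measurable lebesgue \<and>
     (\<forall>K. compact K \<longrightarrow> set_integrable lebesgue K (\<lambda>x. \<bar>f x\<bar> powr p))"

definition test_function :: "('a::real_normed_vector \<Rightarrow> real) \<Rightarrow> bool" where
  "test_function \<phi> \<longleftrightarrow> Cinfty_on UNIV \<phi> \<and> compact (closure {x. \<phi> x \<noteq> 0})"

text \<open>Integrability is stated explicitly because the integral of a non-integrable function is
  \<open>0\<close> by convention.\<close>

definition distributional_solution :: "real \<Rightarrow> (real ^ 'n::finite \<Rightarrow> real) \<Rightarrow> bool" where
  "distributional_solution p u \<longleftrightarrow>
     (\<forall>\<phi>. test_function \<phi> \<longrightarrow>
        integrable lebesgue (\<lambda>x. u x * bilaplacian \<phi> x) \<and>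
        integrable lebesgue (\<lambda>x. u x powr p * \<phi> x) \<and>
        (LINT x|lebesgue. u x * bilaplacian \<phi> x) = (LINT x|lebesgue. u x powr p * \<phi> x))"

end

theory Submission
  imports Defs
begin

section \<open>Idea of the proof\<close>

text \<open>Let \<open>N\<close> be the dimension of the space and \<open>q = p / (p - 1)\<close> the exponent conjugate to \<open>p\<close>.
  What is needed of \<open>Z\<close> is that the volume of its \<open>r\<close>-neighbourhood is at most a constant
  times \<open>r powr (4 * q)\<close>. If the upper Minkowski dimension is less than \<open>N - 4 * q\<close>, then this follows
  by enlarging the balls of efficient coverings (\<open>minkowski_nbhd_bound\<close>); for a manifold of dimension
  at most \<open>N - 4 * q\<close>, such coverings are images of lattices under charts
  (\<open>covering_exponent_closed_manifold\<close>).

  The bilaplacian of a function that is cut off near \<open>Z\<close> at scale \<open>\<epsilon>\<close> has size \<open>(1 / \<epsilon>) ^ 4\<close> on a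
  neighbourhood of \<open>Z\<close> of width comparable to \<open>\<epsilon>\<close>. By the volume bound its \<open>L^q\<close> norm there stays
  bounded as \<open>\<epsilon>\<close> tends to zero (\<open>lint_weight\<close>). Two consequences are drawn from this.

  First, test the equation with a high power \<open>h ^ m\<close> of a cut-off bump function. Its bilaplacian
  retains the power \<open>h ^ (m - 4)\<close> (\<open>dbound_power\<close>), and for \<open>m \<ge> 4 * q\<close> Young's inequality absorbs
  the integral of \<open>u\<close> against this bilaplacian into the integral of \<open>u powr p * h ^ m\<close>, up to a constant
  that does not depend on \<open>\<epsilon>\<close> (\<open>energy_bound\<close>). Removing the cutoff shows that \<open>u powr p\<close> is locally
  integrable across \<open>Z\<close>.

  Secondly, test the equation with \<open>(1 - \<zeta>) * \<phi>\<close> for a given test function \<open>\<phi>\<close> and a cutoff \<open>\<zeta>\<close>. The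
  error made by dropping \<open>\<zeta>\<close> is, by Young's inequality with a parameter, controlled by the integral of
  \<open>u powr p\<close> over neighbourhoods shrinking to the null set \<open>Z\<close>, and therefore vanishes in the limit
  (\<open>weak_solution\<close>).

  The tools are a pointwise calculus for bounds on partial derivatives (\<open>dbound\<close>), cutoff functions
  obtained by mollification with constants independent of \<open>Z\<close> and \<open>\<epsilon>\<close> (\<open>cutoff\<close>), and integration by
  parts against compactly supported functions (\<open>integration_by_parts_bilaplacian\<close>).\<close>

section \<open>Functions of class \<open>C^k\<close>\<close>

lemma Ck_on_cong:
  assumes "open S" "\<And>x. x \<in> S \<Longrightarrow> f x = g x" "Ck_on k S f"
  shows "Ck_on k S g"
  using assms(2,3)
proof (induction k arbitrary: f g)
  case 0
  then show ?case using continuous_on_cong by fastforce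
next
  case (Suc k)
  have eq: "(f has_derivative D) (at x) = (g has_derivative D) (at x)" if "x \<in> S" for x D
    using that Suc.prems(1) assms(1) by (metis has_derivative_transform_within_open)
  then have d: "frechet_derivative f (at x) = frechet_derivative g (at x)" if "x \<in> S" for x
    using that unfolding frechet_derivative_def by simp
  have "Ck_on k S (\<lambda>x. frechet_derivative g (at x) v)" for v
    by (rule Suc.IH[of "\<lambda>x. frechet_derivative f (at x) v"]) (use Suc.prems(2) d in auto)
  moreover have "g differentiable (at x)" if "x \<in> S" for x
    using Suc.prems(2) that unfolding Ck_on.simps differentiable_def eq[OF that, symmetric] by blast
  ultimately show ?case by auto
qed

text \<open>The definition of \<open>Ck_on\<close> speaks of \<open>frechet_derivative\<close>, which is chosen by a description
operator; this rule lets a derivative be supplied by an explicit formula instead.\<close>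

lemma Ck_on_SucI:
  assumes "open S" "\<And>x. x \<in> S \<Longrightarrow> (f has_derivative f' x) (at x)"
    "\<And>v. Ck_on k S (\<lambda>x. f' x v)"
  shows "Ck_on (Suc k) S f"
proof -
  have "f' x = frechet_derivative f (at x)" if "x \<in> S" for x
    using assms(2)[OF that] by (rule frechet_derivative_at)
  then have "Ck_on k S (\<lambda>x. frechet_derivative f (at x) v)" for v
    using Ck_on_cong[OF assms(1), of "\<lambda>x. f' x v" "\<lambda>x. frechet_derivative f (at x) v" k] assms(3) by simp
  then show ?thesis using assms(2) by (auto simp: differentiable_def)
qed

lemma Ck_on_has_derivative:
  "Ck_on (Suc k) S f \<Longrightarrow> x \<in> S \<Longrightarrow> (f has_derivative frechet_derivative f (at x)) (at x)"
  using frechet_derivative_works by auto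

lemma Ck_on_subset: "Ck_on k S f \<Longrightarrow> T \<subseteq> S \<Longrightarrow> Ck_on k T f"
  by (induction k arbitrary: f) (auto intro: continuous_on_subset)

lemma Ck_on_continuous: "Ck_on k S f \<Longrightarrow> continuous_on S f"
  by (cases k) (auto simp: continuous_at_imp_continuous_on differentiable_imp_continuous_within)

lemma Ck_on_lower: "Ck_on k S f \<Longrightarrow> j \<le> k \<Longrightarrow> Ck_on j S f"
proof (induction j arbitrary: f k)
  case 0
  then show ?case by (simp add: Ck_on_continuous)
next
  case (Suc j)
  then obtain k' where "k = Suc k'" "j \<le> k'" by (cases k) auto
  then show ?case using Suc by auto
qed

lemma Ck_on_const: "Ck_on k S (\<lambda>x. c)"
  by (induction k arbitrary: c) auto

lemma Ck_on_bounded_linear: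
  assumes "open S" "bounded_linear f" shows "Ck_on k S f"
proof (cases k)
  case 0
  then show ?thesis using assms by (simp add: linear_continuous_on)
next
  case (Suc j)
  show ?thesis unfolding Suc
    by (rule Ck_on_SucI[OF assms(1), where f'="\<lambda>x. f"])
      (auto intro: bounded_linear_imp_has_derivative assms Ck_on_const)
qed

lemma Ck_on_add:
  assumes "open S" "Ck_on k S f" "Ck_on k S g" shows "Ck_on k S (\<lambda>x. f x + g x)"
  using assms(2,3)
proof (induction k arbitrary: f g)
  case 0
  then show ?case by (auto intro: continuous_intros)
next
  case (Suc k)
  have D: "Ck_on k S (\<lambda>x. frechet_derivative f (at x) v)" "Ck_on k S (\<lambda>x. frechet_derivative g (at x) v)" for v
    using Suc.prems by auto
  show ?case
    by (rule Ck_on_SucI[OF assms(1) has_derivative_add[OF Ck_on_has_derivative[OF Suc.prems(1)] Ck_on_has_derivative[OF Suc.prems(2)]]])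
      (simp_all add: Suc.IH D)
qed

lemma Ck_on_mult:
  fixes f g :: "'a::real_normed_vector \<Rightarrow> real"
  assumes "open S" "Ck_on k S f" "Ck_on k S g" shows "Ck_on k S (\<lambda>x. f x * g x)"
  using assms(2,3)
proof (induction k arbitrary: f g)
  case 0
  then show ?case by (auto intro: continuous_intros)
next
  case (Suc k)
  have C: "Ck_on k S f" "Ck_on k S g" using Suc.prems[THEN Ck_on_lower, of k] by auto
  have D: "Ck_on k S (\<lambda>x. frechet_derivative f (at x) v)" "Ck_on k S (\<lambda>x. frechet_derivative g (at x) v)" for v
    using Suc.prems by auto
  show ?case
    by (rule Ck_on_SucI[OF assms(1) has_derivative_mult[OF Ck_on_has_derivative[OF Suc.prems(1)] Ck_on_has_derivative[OF Suc.prems(2)]]])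
      (simp_all add: Ck_on_add assms(1) Suc.IH C D)
qed

lemma Ck_on_sum:
  assumes "open S" "\<And>i. i \<in> I \<Longrightarrow> Ck_on k S (f i)" shows "Ck_on k S (\<lambda>x. \<Sum>i\<in>I. f i x)"
  using assms(2)
  by (induction I rule: infinite_finite_induct) (auto intro: Ck_on_const Ck_on_add assms(1))

lemma Ck_on_power:
  fixes f :: "'a::real_normed_vector \<Rightarrow> real"
  assumes "open S" "Ck_on k S f" shows "Ck_on k S (\<lambda>x. f x ^ m)"
  by (induction m) (auto intro: Ck_on_const Ck_on_mult assms)

lemma Ck_on_compose_scale:
  assumes "Ck_on k UNIV f" shows "Ck_on k UNIV (\<lambda>x. f (c *\<^sub>R x))"
  using assms
proof (induction k arbitrary: f)
  case 0
  then show ?case by (auto intro!: continuous_intros intro: continuous_on_compose2)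
next
  case (Suc k)
  have 1: "((\<lambda>x. f (c *\<^sub>R x)) has_derivative (\<lambda>v. frechet_derivative f (at (c *\<^sub>R x)) (c *\<^sub>R v))) (at x)" for x
    by (rule has_derivative_compose[of "\<lambda>x. c *\<^sub>R x"])
     (auto intro!: derivative_eq_intros Ck_on_has_derivative[OF Suc.prems])
  show ?case
    by (rule Ck_on_SucI[OF open_UNIV 1]) (use Suc in auto)
qed

section \<open>Coordinate derivatives\<close>

lemma Ck_on_partial_deriv: "Ck_on (Suc k) S f \<Longrightarrow> Ck_on k S (partial_deriv i f)"
  unfolding partial_deriv_def by simp

lemma Ck_on_laplacian:
  assumes "open S" "Ck_on (Suc (Suc k)) S f" shows "Ck_on k S (laplacian f)"
proof -
  have "Ck_on k S (\<lambda>x. \<Sum>i\<in>UNIV. partial_deriv i (partial_deriv i f) x)"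
    by (rule Ck_on_sum[OF assms(1)]) (intro Ck_on_partial_deriv assms(2))
  then show ?thesis by (simp add: laplacian_def[abs_def])
qed

lemma partial_derivI: "(f has_derivative f') (at x) \<Longrightarrow> partial_deriv i f x = f' (axis i 1)"
  unfolding partial_deriv_def by (metis frechet_derivative_at)

text \<open>Two functions that agree near \<open>x\<close> have the same derivatives there. If they have none, then both
sides are the same arbitrary value.\<close>

lemma partial_deriv_cong_open:
  assumes "open S" "x \<in> S" "\<And>y. y \<in> S \<Longrightarrow> f y = g y"
  shows "partial_deriv i f x = partial_deriv i g x"
proof -
  have "(f has_derivative D) (at x) = (g has_derivative D) (at x)" for D
    using assms by (metis has_derivative_transform_within_open)
  then show ?thesis unfolding partial_deriv_def frechet_derivative_def by simp
qed

lemma laplacian_cong_open: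
  assumes "open S" "x \<in> S" "\<And>y. y \<in> S \<Longrightarrow> f y = g y"
  shows "laplacian f x = laplacian g x"
  unfolding laplacian_def
  by (intro sum.cong refl partial_deriv_cong_open[OF assms(1,2)] partial_deriv_cong_open[OF assms(1) _ assms(3)])

lemma bilaplacian_cong_open:
  assumes "open S" "x \<in> S" "\<And>y. y \<in> S \<Longrightarrow> f y = g y"
  shows "bilaplacian f x = bilaplacian g x"
  unfolding bilaplacian_def
  by (intro laplacian_cong_open[OF assms(1,2)] laplacian_cong_open[OF assms(1) _ assms(3)])

lemma partial_deriv_mult:
  assumes "Ck_on (Suc k) UNIV f" "Ck_on (Suc k) UNIV g"
  shows "partial_deriv i (\<lambda>x. f x * g x) = (\<lambda>x. f x * partial_deriv i g x + partial_deriv i f x * g x)"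
  using partial_derivI[OF has_derivative_mult[OF Ck_on_has_derivative[OF assms(1)] Ck_on_has_derivative[OF assms(2)]]]
  by (auto simp: partial_deriv_def)

lemma partial_deriv_add:
  assumes "Ck_on (Suc k) UNIV f" "Ck_on (Suc k) UNIV g"
  shows "partial_deriv i (\<lambda>x. f x + g x) = (\<lambda>x. partial_deriv i f x + partial_deriv i g x)"
  using partial_derivI[OF has_derivative_add[OF Ck_on_has_derivative[OF assms(1)] Ck_on_has_derivative[OF assms(2)]]]
  by (auto simp: partial_deriv_def)

lemma partial_deriv_sum:
  assumes "\<And>j. j \<in> J \<Longrightarrow> Ck_on (Suc k) UNIV (f j)"
  shows "partial_deriv i (\<lambda>x. \<Sum>j\<in>J. f j x) = (\<lambda>x. \<Sum>j\<in>J. partial_deriv i (f j) x)"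
proof
  fix x
  show "partial_deriv i (\<lambda>x. \<Sum>j\<in>J. f j x) x = (\<Sum>j\<in>J. partial_deriv i (f j) x)"
    using partial_derivI[OF has_derivative_sum[where f=f, OF Ck_on_has_derivative[OF assms]], of J x i]
    by (auto simp: partial_deriv_def)
qed

lemma partial_deriv_const [simp]: "partial_deriv i (\<lambda>x. c) = (\<lambda>x. 0)"
  by (auto simp: partial_deriv_def)

lemma partial_deriv_scale:
  assumes "Ck_on (Suc k) UNIV f"
  shows "partial_deriv i (\<lambda>x. f (c *\<^sub>R x)) = (\<lambda>x. c * partial_deriv i f (c *\<^sub>R x))"
proof
  fix x
  have 1: "((\<lambda>x. f (c *\<^sub>R x)) has_derivative (\<lambda>v. frechet_derivative f (at (c *\<^sub>R x)) (c *\<^sub>R v))) (at x)"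
    by (rule has_derivative_compose[of "\<lambda>x. c *\<^sub>R x"])
     (auto intro!: derivative_eq_intros Ck_on_has_derivative[OF assms])
  have "linear (frechet_derivative f (at (c *\<^sub>R x)))"
    using assms by (auto intro: linear_frechet_derivative)
  then show "partial_deriv i (\<lambda>x. f (c *\<^sub>R x)) x = c * partial_deriv i f (c *\<^sub>R x)"
    using partial_derivI[OF 1, of i] by (simp add: partial_deriv_def linear_cmul)
qed

lemma partial_deriv_vanish:
  assumes "closed S" "\<And>x. x \<notin> S \<Longrightarrow> f x = 0" "x \<notin> S"
  shows "partial_deriv i f x = 0"
  using partial_deriv_cong_open[of "-S" x f "\<lambda>x. 0" i] assms by auto

lemma laplacian_vanish:
  assumes "closed S" "\<And>x. x \<notin> S \<Longrightarrow> f x = 0" "x \<notin> S"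
  shows "laplacian f x = 0"
  unfolding laplacian_def by (simp add: partial_deriv_vanish[OF assms(1) _ assms(3)] partial_deriv_vanish[OF assms(1,2)])

lemma bilaplacian_vanish:
  assumes "closed S" "\<And>x. x \<notin> S \<Longrightarrow> f x = 0" "x \<notin> S"
  shows "bilaplacian f x = 0"
  unfolding bilaplacian_def by (rule laplacian_vanish[OF assms(1) laplacian_vanish[OF assms(1,2)] assms(3)])

section \<open>Pointwise bounds on all partial derivatives\<close>

text \<open>A bound \<open>B j x\<close> for every mixed partial derivative of order \<open>j \<le> k\<close> at \<open>x\<close>. Letting the bound
depend on the point and on the order is what allows the calculus below to keep track of powers of
a weight that is large only near the singular set, and of powers of the differentiated function.
The recursion differentiates once and shifts the sequence of bounds.\<close>

primrec dbound :: "nat \<Rightarrow> (nat \<Rightarrow> real ^ 'n::finite \<Rightarrow> real) \<Rightarrow> (real ^ 'n \<Rightarrow> real) \<Rightarrow> bool" where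
  "dbound 0 B f \<longleftrightarrow> (\<forall>x. \<bar>f x\<bar> \<le> B 0 x)"
| "dbound (Suc k) B f \<longleftrightarrow>
     (\<forall>x. \<bar>f x\<bar> \<le> B 0 x) \<and> (\<forall>i. dbound k (\<lambda>j. B (Suc j)) (partial_deriv i f))"

lemma dbound_0: "dbound k B f \<Longrightarrow> \<bar>f x\<bar> \<le> B 0 x"
  by (cases k) auto

lemma dbound_mono:
  assumes "dbound k B f" "\<And>j x. j \<le> k \<Longrightarrow> B j x \<le> B' j x"
  shows "dbound k B' f"
  using assms
proof (induction k arbitrary: B B' f)
  case 0
  then show ?case using order_trans by fastforce
next
  case (Suc k)
  have "\<bar>f x\<bar> \<le> B' 0 x" for x
    using dbound_0[OF Suc.prems(1), of x] Suc.prems(2)[of 0 x] by simp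
  moreover have "dbound k (\<lambda>j. B' (Suc j)) (partial_deriv i f)" for i
    by (rule Suc.IH[of "\<lambda>j. B (Suc j)"]) (use Suc.prems in auto)
  ultimately show ?case by simp
qed

lemma dbound_lower: "dbound (Suc k) B f \<Longrightarrow> dbound k B f"
  by (induction k arbitrary: B f) auto

lemma dbound_add:
  assumes "Ck_on k UNIV f" "Ck_on k UNIV g" "dbound k B f" "dbound k B' g"
  shows "dbound k (\<lambda>j x. B j x + B' j x) (\<lambda>x. f x + g x)"
  using assms
proof (induction k arbitrary: B B' f g)
  case 0
  then show ?case by (simp add: abs_triangle_ineq order_trans[OF abs_triangle_ineq] add_mono)
next
  case (Suc k)
  have "\<bar>f x + g x\<bar> \<le> B 0 x + B' 0 x" for x
    using dbound_0[OF Suc.prems(3), of x] dbound_0[OF Suc.prems(4), of x] by linarith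
  moreover have "dbound k (\<lambda>j x. B (Suc j) x + B' (Suc j) x) (\<lambda>x. partial_deriv i f x + partial_deriv i g x)" for i
    using Suc by (intro Suc.IH Ck_on_partial_deriv) auto
  ultimately show ?case using partial_deriv_add[OF Suc.prems(1,2)] by auto
qed

text \<open>Each of the \<open>j\<close> differentiations of a product doubles the number of terms, and a term in which
  \<open>i\<close> of them fall on \<open>f\<close> is at most \<open>B i x * B' (j - i) x\<close>.\<close>

lemma dbound_mult:
  assumes "Ck_on k UNIV f" "Ck_on k UNIV g" "dbound k B f" "dbound k B' g"
    "\<And>i j x. i + j \<le> k \<Longrightarrow> B i x * B' j x \<le> D (i + j) x"
  shows "dbound k (\<lambda>j x. 2 ^ j * D j x) (\<lambda>x. f x * g x)"
  using assms
proof (induction k arbitrary: B B' D f g)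
  case 0
  have "\<bar>f x * g x\<bar> \<le> D 0 x" for x
    using 0(3,4) 0(5)[of 0 0 x] by (auto simp: abs_mult intro: order_trans[OF mult_mono'])
  then show ?case by simp
next
  case (Suc k)
  have "\<bar>f x * g x\<bar> \<le> B 0 x * B' 0 x" for x
    using dbound_0[OF Suc.prems(3), of x] dbound_0[OF Suc.prems(4), of x]
    by (auto simp: abs_mult intro: mult_mono')
  then have 0: "\<bar>f x * g x\<bar> \<le> 2 ^ 0 * D 0 x" for x
    using Suc.prems(5)[of 0 0 x] order_trans by fastforce
  have "dbound k (\<lambda>j x. 2 ^ Suc j * D (Suc j) x) (partial_deriv i (\<lambda>x. f x * g x))" for i
  proof -
    have C: "Ck_on k UNIV f" "Ck_on k UNIV g" "Ck_on k UNIV (partial_deriv i f)" "Ck_on k UNIV (partial_deriv i g)"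
      using Suc.prems(1,2)[THEN Ck_on_lower, of k] Suc.prems(1,2)[THEN Ck_on_partial_deriv] by auto
    have 1: "dbound k (\<lambda>j x. 2 ^ j * D (Suc j) x) (\<lambda>x. f x * partial_deriv i g x)"
      by (rule Suc.IH[OF C(1,4) dbound_lower[OF Suc.prems(3)], of "\<lambda>j. B' (Suc j)"])
        (use Suc.prems in \<open>auto simp flip: add_Suc_right\<close>)
    have 2: "dbound k (\<lambda>j x. 2 ^ j * D (Suc j) x) (\<lambda>x. partial_deriv i f x * g x)"
      by (rule Suc.IH[OF C(3,2) _ dbound_lower[OF Suc.prems(4)], of "\<lambda>j. B (Suc j)"])
        (use Suc.prems in \<open>auto simp flip: add_Suc\<close>)
    have "dbound k (\<lambda>j x. 2 ^ j * D (Suc j) x + 2 ^ j * D (Suc j) x) (\<lambda>x. f x * partial_deriv i g x + partial_deriv i f x * g x)"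
      using C by (intro dbound_add 1 2 Ck_on_mult) auto
    then show ?thesis unfolding partial_deriv_mult[OF Suc.prems(1,2)] by (simp add: mult_ac)
  qed
  with 0 show ?case by auto
qed

text \<open>Induction needs a factor \<open>d\<close> in front of the function, since each differentiation produces another
factor \<open>c\<close>.\<close>

lemma dbound_scale:
  assumes "Ck_on k UNIV f" "dbound k B f"
  shows "dbound k (\<lambda>j x. \<bar>c\<bar> ^ j * B j (c *\<^sub>R x)) (\<lambda>x. f (c *\<^sub>R x))"
proof -
  have "dbound k (\<lambda>j x. \<bar>d\<bar> * \<bar>c\<bar> ^ j * B j (c *\<^sub>R x)) (\<lambda>x. d * f (c *\<^sub>R x))" for d
    using assms
  proof (induction k arbitrary: B f d)
    case 0
    then show ?case by (auto simp: abs_mult intro: mult_left_mono)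
  next
    case (Suc k)
    have 1: "partial_deriv i (\<lambda>x. d * f (c *\<^sub>R x)) = (\<lambda>x. (d * c) * partial_deriv i f (c *\<^sub>R x))" for i
      using partial_deriv_mult[OF Ck_on_const Ck_on_compose_scale[OF Suc.prems(1)]] partial_deriv_scale[OF Suc.prems(1)]
      by (auto simp: fun_eq_iff)
    have "\<bar>d * f (c *\<^sub>R x)\<bar> \<le> \<bar>d\<bar> * \<bar>c\<bar> ^ 0 * B 0 (c *\<^sub>R x)" for x
      using dbound_0[OF Suc.prems(2), of "c *\<^sub>R x"] by (auto simp: abs_mult intro: mult_left_mono)
    moreover have "dbound k (\<lambda>j x. \<bar>d * c\<bar> * \<bar>c\<bar> ^ j * B (Suc j) (c *\<^sub>R x)) (\<lambda>x. (d * c) * partial_deriv i f (c *\<^sub>R x))" for i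
      using Suc by (intro Suc.IH Ck_on_partial_deriv) auto
    ultimately show ?case unfolding dbound.simps 1 by (simp add: abs_mult mult.assoc)
  qed
  from this[of 1] show ?thesis by simp
qed

lemma dbound_vanish:
  assumes "closed S" "\<And>x. x \<notin> S \<Longrightarrow> f x = 0" "dbound k B f"
  shows "dbound k (\<lambda>j x. if x \<in> S then B j x else 0) f"
  using assms(2,3)
proof (induction k arbitrary: f B)
  case 0
  then show ?case by auto
next
  case (Suc k)
  then show ?case using partial_deriv_vanish[OF assms(1) Suc.prems(1)] by (auto dest: dbound_0)
qed

lemma dbound_const: "dbound k (\<lambda>j x. if j = 0 then \<bar>c\<bar> else 0) (\<lambda>x. c)"
proof (induction k arbitrary: c)
  case (Suc k)
  show ?case using dbound_mono[OF Suc.IH[of 0]] by auto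
qed auto

lemma Ck_compact_support_dbound:
  fixes f :: "real ^ 'n::finite \<Rightarrow> real"
  assumes "Ck_on k UNIV f" "compact K" "\<And>x. x \<notin> K \<Longrightarrow> f x = 0"
  shows "\<exists>M\<ge>0. dbound k (\<lambda>j x. M) f"
  using assms(1,3)
proof (induction k arbitrary: f)
  have b: "\<exists>M\<ge>0. \<forall>x. \<bar>f x\<bar> \<le> M" if "Ck_on k UNIV f" "\<And>x. x \<notin> K \<Longrightarrow> f x = 0" for f :: "real^'n \<Rightarrow> real" and k
  proof -
    have "bounded (f ` K)"
      by (intro compact_imp_bounded compact_continuous_image assms(2) continuous_on_subset[OF Ck_on_continuous[OF that(1)]]) auto
    then obtain M where "\<forall>x\<in>K. \<bar>f x\<bar> \<le> M" by (auto simp: bounded_iff)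
    then have "\<bar>f x\<bar> \<le> max M 0" for x
      using that(2)[of x] by (cases "x \<in> K") (auto intro: max.coboundedI1)
    then show ?thesis by (intro exI[of _ "max M 0"]) auto
  qed
  {
    case 0
    then show ?case using b[of 0 f] by simp
  next
    case (Suc k)
    obtain M where M: "M \<ge> 0" "\<And>x. \<bar>f x\<bar> \<le> M" using b[OF Suc.prems] by auto
    have "\<exists>M\<ge>0. dbound k (\<lambda>j x. M) (partial_deriv i f)" for i
      by (rule Suc.IH[OF Ck_on_partial_deriv[OF Suc.prems(1)]])
        (rule partial_deriv_vanish[OF compact_imp_closed[OF assms(2)] Suc.prems(2)])
    then obtain m where m: "\<And>i. m i \<ge> 0" "\<And>i. dbound k (\<lambda>j x. m i) (partial_deriv i f)" by metis
    have "m i \<le> M + sum m UNIV" for i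
      using member_le_sum[of i UNIV m] m(1) M(1) by (simp add: add_increasing)
    then have "dbound k (\<lambda>j x. M + sum m UNIV) (partial_deriv i f)" for i
      by (intro dbound_mono[OF m(2)])
    moreover have "\<bar>f x\<bar> \<le> M + sum m UNIV" for x
      using M(2)[of x] m(1) by (simp add: add_increasing2 sum_nonneg)
    ultimately show ?case using M(1) m(1) by (intro exI[of _ "M + sum m UNIV"]) (auto simp: sum_nonneg)
  }
qed

lemma dbound_bilaplacian:
  fixes f :: "real ^ 'n::finite \<Rightarrow> real"
  assumes "Ck_on 4 UNIV f" "dbound 4 B f"
  shows "\<bar>bilaplacian f x\<bar> \<le> real (CARD('n)) ^ 2 * B 4 x"
proof -
  have C: "Ck_on 2 UNIV (partial_deriv j (partial_deriv j f))" for j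
    using assms(1) by (intro Ck_on_partial_deriv) (simp add: numeral_eq_Suc del: Ck_on.simps)
  have 1: "partial_deriv i (\<lambda>x. \<Sum>j\<in>UNIV. partial_deriv j (partial_deriv j f) x)
     = (\<lambda>x. \<Sum>j\<in>UNIV. partial_deriv i (partial_deriv j (partial_deriv j f)) x)" for i
    by (rule partial_deriv_sum[where k=1]) (use C in \<open>simp add: numeral_2_eq_2 del: Ck_on.simps\<close>)
  have 2: "partial_deriv i (\<lambda>x. \<Sum>j\<in>UNIV. partial_deriv i (partial_deriv j (partial_deriv j f)) x)
     = (\<lambda>x. \<Sum>j\<in>UNIV. partial_deriv i (partial_deriv i (partial_deriv j (partial_deriv j f))) x)" for i
    by (rule partial_deriv_sum[where k=0]) (rule Ck_on_partial_deriv, use C in \<open>simp add: numeral_2_eq_2 del: Ck_on.simps\<close>)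
  have "bilaplacian f x = (\<Sum>i\<in>UNIV. \<Sum>j\<in>UNIV. partial_deriv i (partial_deriv i (partial_deriv j (partial_deriv j f))) x)"
    unfolding bilaplacian_def laplacian_def[abs_def] 1 2 ..
  also have "\<bar>\<dots>\<bar> \<le> (\<Sum>i\<in>(UNIV::'n set). \<Sum>j\<in>(UNIV::'n set). B 4 x)"
    by (intro order_trans[OF sum_abs] sum_mono) (use assms(2) in \<open>auto simp: numeral_eq_Suc\<close>)
  finally show ?thesis by (simp add: power2_eq_square mult.assoc)
qed

section \<open>A bump function with finitely many derivatives\<close>

text \<open>Only the square has to be treated by hand at the origin. The higher powers follow by the product
rule, because the positive part satisfies \<open>max 0 t ^ (j + 1) = t * max 0 t ^ j\<close> for \<open>j > 0\<close>.\<close>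

lemma has_derivative_pos_part_power:
  "((\<lambda>t. max 0 t ^ (k + 2)) has_real_derivative (real k + 2) * max 0 t ^ (k + 1)) (at (t::real))"
proof (induction k)
  case 0
  consider "t < 0" | "t = 0" | "t > 0" by linarith
  then show ?case
  proof cases
    case 1
    have "((\<lambda>t. 0) has_real_derivative 0) (at t)" by simp
    then have "((\<lambda>t. max 0 t ^ 2) has_real_derivative 0) (at t)"
      by (rule has_field_derivative_transform_within_open[where S="{..<0}"]) (use 1 in auto)
    then show ?thesis using 1 by (simp add: power2_eq_square)
  next
    case 2
    have "((\<lambda>h::real. max 0 h ^ 2 / h) \<longlongrightarrow> 0) (at 0)"
      by (rule Lim_null_comparison[where g="\<lambda>h. \<bar>h\<bar>"])
        (auto intro!: tendsto_eq_intros always_eventually simp: power2_eq_square max_def)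
    then show ?thesis using 2 by (simp add: DERIV_def power2_eq_square)
  next
    case 3
    have "((\<lambda>t. t ^ 2) has_real_derivative 2 * t) (at t)" by (auto intro!: derivative_eq_intros)
    then have "((\<lambda>t. max 0 t ^ 2) has_real_derivative 2 * t) (at t)"
      by (rule has_field_derivative_transform_within_open[where S="{0<..}"]) (use 3 in auto)
    then show ?thesis using 3 by (simp add: power2_eq_square)
  qed
next
  case (Suc k)
  have e1: "max 0 s ^ (Suc k + 2) = s * max 0 s ^ (k + 2)" for s :: real
    by (auto simp: max_def)
  have e2: "t * max 0 t ^ (k + 1) = max 0 t ^ (k + 2)"
    by (auto simp: max_def)
  have "((\<lambda>t. t * max 0 t ^ (k + 2)) has_real_derivative
      t * ((real k + 2) * max 0 t ^ (k + 1)) + max 0 t ^ (k + 2)) (at t)"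
    by (rule derivative_eq_intros Suc refl)+ simp
  moreover have "t * ((real k + 2) * max 0 t ^ (k + 1)) + max 0 t ^ (k + 2)
      = (real (Suc k) + 2) * max 0 t ^ (Suc k + 1)"
    unfolding mult.left_commute[of t] e2 by (simp add: algebra_simps)
  ultimately show ?case unfolding e1 by simp
qed

text \<open>Four derivatives are enough for the bilaplacian, so that a polynomial profile can replace the
usual exponential one: the \<open>k\<close>-th power of the positive part is of class \<open>C^(k-1)\<close> across the
unit sphere.\<close>

definition bump :: "nat \<Rightarrow> 'a::real_inner \<Rightarrow> real" where
  "bump k x = max 0 (1 - x \<bullet> x) ^ k"

lemma Ck_on_bump: "Ck_on k UNIV (bump (Suc k) :: 'a::real_inner \<Rightarrow> real)"
proof (induction k)
  case 0
  then show ?case by (auto simp: bump_def[abs_def] intro!: continuous_intros)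
next
  case (Suc k)
  have "((\<lambda>x::'a. 1 - x \<bullet> x) has_derivative (\<lambda>v. - (2 * (x \<bullet> v)))) (at x)" for x
    by (auto intro!: derivative_eq_intros simp: inner_commute)
  from DERIV_compose_FDERIV[OF has_derivative_pos_part_power this]
  have 1: "(bump (Suc (Suc k)) has_derivative (\<lambda>v. - (2 * (x \<bullet> v)) * ((real k + 2) * bump (Suc k) x))) (at x)" for x :: 'a
    by (simp add: bump_def[abs_def])
  have "Ck_on k UNIV (\<lambda>x::'a. - (2 * (x \<bullet> v)))" for v
    by (intro Ck_on_bounded_linear) (intro open_UNIV bounded_linear_minus bounded_linear_const_mult bounded_linear_inner_left)+
  then show ?case
    by (intro Ck_on_SucI[OF open_UNIV 1] Ck_on_mult Ck_on_const Suc) auto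
qed

lemma bump_bounds: "0 \<le> bump k x" "bump k x \<le> 1"
  by (auto simp: bump_def intro!: power_le_one)

lemma bump_vanish: "k > 0 \<Longrightarrow> norm x \<ge> 1 \<Longrightarrow> bump k x = 0"
  by (simp add: bump_def max_def) (smt (verit) dot_square_norm one_le_power)

lemma bump_ge: "norm x \<le> 1/2 \<Longrightarrow> bump k x \<ge> (3/4) ^ k"
proof -
  assume "norm x \<le> 1/2"
  then have "x \<bullet> x \<le> (1/2)^2" unfolding dot_square_norm by (intro power_mono) auto
  then show ?thesis unfolding bump_def by (intro power_mono) (auto simp: power2_eq_square)
qed

section \<open>Integrals of continuous functions with compact support\<close>

lemma integrable_compact_support:
  fixes f :: "'a::euclidean_space \<Rightarrow> real"
  assumes "continuous_on S f" "compact K" "K \<subseteq> S" "\<And>x. x \<notin> K \<Longrightarrow> f x = 0"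
  shows "integrable lborel f"
proof -
  have "integrable lborel (\<lambda>x. indicator K x *\<^sub>R f x)"
    using assms by (intro borel_integrable_compact) (auto intro: continuous_on_subset)
  moreover have "(\<lambda>x. indicator K x *\<^sub>R f x) = f" using assms(4) by (auto simp: indicator_def fun_eq_iff)
  ultimately show ?thesis by simp
qed

text \<open>This passes between the gauge integral over a box, under which the convolution below is
differentiated, and the Lebesgue integral over the whole space, which is used in the estimates.\<close>

lemma lint_eq_integral_cbox:
  fixes f :: "'a::euclidean_space \<Rightarrow> real"
  assumes "continuous_on UNIV f" "\<And>x. x \<notin> cbox a b \<Longrightarrow> f x = 0"
  shows "(LINT x|lborel. f x) = integral (cbox a b) f"
proof -
  have "integrable lborel f" using assms by (intro integrable_compact_support[of UNIV f "cbox a b"]) auto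
  then have "(LINT x|lborel. f x) = integral UNIV f" by (simp add: integral_lborel)
  also have "\<dots> = integral (cbox a b) f"
    using integral_restrict_UNIV[of "cbox a b" f] assms(2) by (smt (verit) integral_cong)
  finally show ?thesis .
qed

lemma lint_translate:
  fixes f :: "'a::euclidean_space \<Rightarrow> real"
  assumes "f \<in> borel_measurable borel"
  shows "(LINT x|lborel. f (t + x)) = (LINT x|lborel. f x)"
proof -
  have "(LINT x|lborel. f x) = (LINT x|distr lborel borel ((+) t). f x)" by (simp add: lborel_distr_plus)
  also have "\<dots> = (LINT x|lborel. f (t + x))" using assms by (subst integral_distr) auto
  finally show ?thesis by simp
qed

section \<open>Mollification\<close>

definition conv :: "('a \<Rightarrow> real) \<Rightarrow> ('a \<Rightarrow> real) \<Rightarrow> 'a::euclidean_space \<Rightarrow> real" where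
  "conv g K x = (LINT y|lborel. g y * K (x - y))"

lemma conv_eq_integral:
  assumes "continuous_on UNIV g" "\<And>y. y \<notin> cbox a b \<Longrightarrow> g y = 0" "continuous_on UNIV K"
  shows "conv g K x = integral (cbox a b) (\<lambda>y. g y * K (x - y))"
  unfolding conv_def
  by (rule lint_eq_integral_cbox) (use assms in \<open>auto intro!: continuous_intros intro: continuous_on_compose2[OF assms(3)]\<close>)

text \<open>All the \<open>x\<close>-dependence of the convolution sits in the kernel, hence so do all derivatives: the
convolution inherits the smoothness of \<open>K\<close> although \<open>g\<close> is merely continuous.\<close>

lemma conv_has_derivative:
  assumes g: "continuous_on UNIV g" "\<And>y. y \<notin> cbox a b \<Longrightarrow> g y = 0" and K: "Ck_on (Suc 0) UNIV K"
  shows "(conv g K has_derivative (\<lambda>v. conv g (\<lambda>z. frechet_derivative K (at z) v) x)) (at x)"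
proof -
  define D where "D = (\<lambda>z. frechet_derivative K (at z))"
  have D: "(K has_derivative D z) (at z)" for z
    unfolding D_def by (rule Ck_on_has_derivative[OF K]) auto
  then have bl: "bounded_linear (D z)" for z by (rule has_derivative_bounded_linear)
  have cD: "continuous_on UNIV (\<lambda>z. D z v)" for v using K by (simp add: D_def)
  have cK: "continuous_on UNIV K" using K by (rule Ck_on_continuous)
  have blb: "bounded_linear (\<lambda>v. g y * D z v)" for y z
    using bl by (intro bounded_linear_const_mult)
  \<comment> \<open>The derivative of the integrand in \<open>x\<close>, as a point of the space of bounded linear maps.\<close>
  define F where "F = (\<lambda>x y. Blinfun (\<lambda>v. g y * D (x - y) v))"
  have F: "blinfun_apply (F x y) = (\<lambda>v. g y * D (x - y) v)" for x y
    unfolding F_def by (rule bounded_linear_Blinfun_apply[OF blb])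
  have cont: "continuous_on (UNIV \<times> cbox a b) (\<lambda>(x, y). F x y)"
    unfolding split_beta
    by (rule continuous_on_blinfun_componentwise)
      (auto simp: F intro!: continuous_intros intro: continuous_on_compose2[OF g(1)] continuous_on_compose2[OF cD])
  have lz: "((\<lambda>x. integral (cbox a b) (\<lambda>y. g y * K (x - y))) has_derivative integral (cbox a b) (F x)) (at x within UNIV)"
  proof (rule leibniz_rule[OF _ _ cont])
    show "((\<lambda>x. g y * K (x - y)) has_derivative blinfun_apply (F x y)) (at x within UNIV)" for x y
      unfolding F
      by (rule has_derivative_eq_rhs, rule has_derivative_mult_right, rule has_derivative_compose[OF _ D])
       (auto intro!: derivative_eq_intros)
    show "(\<lambda>y. g y * K (x - y)) integrable_on cbox a b" for x
      by (rule integrable_continuous) (auto intro!: continuous_intros intro: continuous_on_subset[OF g(1)] continuous_on_compose2[OF cK])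
  qed auto
  have "blinfun_apply (integral (cbox a b) (F x)) v = conv g (\<lambda>z. D z v) x" for v
  proof -
    have "continuous_on (cbox a b) (F x)"
      using continuous_on_compose[OF continuous_on_Pair[OF continuous_on_const continuous_on_id]
          continuous_on_subset[OF cont], of x "cbox a b"] by (auto simp: o_def)
    then have "F x integrable_on cbox a b" by (rule integrable_continuous)
    from integral_linear[OF this, of "\<lambda>T. blinfun_apply T v"]
    have "integral (cbox a b) (\<lambda>y. g y * D (x - y) v) = blinfun_apply (integral (cbox a b) (F x)) v"
      by (auto simp: o_def F intro!: bounded_linear_intros)
    then show ?thesis using conv_eq_integral[OF g cD] by simp
  qed
  then have "blinfun_apply (integral (cbox a b) (F x)) = (\<lambda>v. conv g (\<lambda>z. D z v) x)" by auto
  moreover have "conv g K = (\<lambda>x. integral (cbox a b) (\<lambda>y. g y * K (x - y)))"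
    using conv_eq_integral[OF g cK] by auto
  ultimately show ?thesis using lz unfolding D_def by simp
qed

lemma Ck_on_conv:
  assumes g: "continuous_on UNIV g" "\<And>y. y \<notin> cbox a b \<Longrightarrow> g y = 0" and K: "Ck_on k UNIV K"
  shows "Ck_on k UNIV (conv g K)"
  using K
proof (induction k arbitrary: K)
  case 0
  have "continuous_on UNIV (\<lambda>x. integral (cbox a b) (\<lambda>y. g y * K (x - y)))"
    by (rule integral_continuous_on_param)
      (use 0 in \<open>auto simp: split_beta intro!: continuous_intros intro: continuous_on_compose2[OF g(1)] continuous_on_compose2[of UNIV K]\<close>)
  then show ?case using conv_eq_integral[OF g, where K=K] 0 by (simp cong: continuous_on_cong)
next
  case (Suc k)
  show ?case
    by (rule Ck_on_SucI[OF open_UNIV conv_has_derivative[OF g]])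
      (use Suc.prems Ck_on_lower[OF Suc.prems, of "Suc 0"] in \<open>auto intro!: Suc.IH\<close>)
qed

text \<open>The kernel lives in a unit ball, so the integral runs over a ball of fixed volume. The bound depends
on \<open>g\<close> only through \<open>0 \<le> g \<le> 1\<close>; this makes the constants for the cutoff functions below
independent of the set around which they cut off.\<close>

lemma abs_conv_le:
  assumes g: "continuous_on UNIV g" "\<And>y. y \<notin> cbox a b \<Longrightarrow> g y = 0" "\<And>y. 0 \<le> g y \<and> g y \<le> 1"
    and K: "continuous_on UNIV (K :: 'a::euclidean_space \<Rightarrow> real)" "\<And>z. z \<notin> cball 0 1 \<Longrightarrow> K z = 0" "\<And>z. \<bar>K z\<bar> \<le> M"
  shows "\<bar>conv g K x\<bar> \<le> M * measure lborel (cball (0::'a) 1)"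
proof -
  have "M \<ge> 0" using K(3)[of 0] by linarith
  have "\<bar>conv g K x\<bar> \<le> (LINT y|lborel. M * indicator (cball x 1) y)"
    unfolding conv_def
  proof (rule order_trans[OF integral_abs_bound integral_mono])
    show "integrable lborel (\<lambda>y. \<bar>g y * K (x - y)\<bar>)"
      by (rule integrable_abs, rule integrable_compact_support[of UNIV _ "cbox a b"])
       (use g in \<open>auto intro!: continuous_intros intro: continuous_on_compose2[OF K(1)]\<close>)
    show "integrable lborel (\<lambda>y. M * indicator (cball x 1) y)"
      by (intro integrable_mult_right) (use emeasure_lborel_cball_finite[of x 1] in \<open>auto intro!: integrable_real_indicator\<close>)
    fix y
    show "\<bar>g y * K (x - y)\<bar> \<le> M * indicator (cball x 1) y"
      using K(2)[of "x - y"] mult_mono[of "\<bar>g y\<bar>" 1 "\<bar>K (x - y)\<bar>" M] K(3)[of "x - y"] g(3)[of y]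
      by (auto simp: indicator_def abs_mult dist_norm norm_minus_commute)
  qed
  also have "\<dots> = M * measure lborel (cball x 1)" by simp
  also have "measure lborel (cball x 1) = measure lborel (cball (0::'a) 1)"
    by (simp add: content_cball)
  finally show ?thesis .
qed

lemma dbound_conv:
  fixes g :: "real ^ 'n::finite \<Rightarrow> real"
  assumes g: "continuous_on UNIV g" "\<And>y. y \<notin> cbox a b \<Longrightarrow> g y = 0" "\<And>y. 0 \<le> g y \<and> g y \<le> 1"
    and K: "Ck_on k UNIV K" "\<And>z. z \<notin> cball 0 1 \<Longrightarrow> K z = 0" "dbound k (\<lambda>j x. M) K"
  shows "dbound k (\<lambda>j x. M * measure lborel (cball (0 :: real ^ 'n) 1)) (conv g K)"
  using K
proof (induction k arbitrary: K)
  case 0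
  then show ?case using abs_conv_le[OF g, where K=K and M=M] by auto
next
  case (Suc k)
  have "partial_deriv i (conv g K) = conv g (partial_deriv i K)" for i
    using partial_derivI[OF conv_has_derivative[OF g(1,2)]] Ck_on_lower[OF Suc.prems(1), of "Suc 0"]
    by (auto simp: partial_deriv_def[abs_def])
  moreover have "dbound k (\<lambda>j x. M * measure lborel (cball (0 :: real ^ 'n) 1)) (conv g (partial_deriv i K))" for i
  proof (rule Suc.IH[OF Ck_on_partial_deriv[OF Suc.prems(1)]])
    show "partial_deriv i K z = 0" if "z \<notin> cball 0 1" for z
      by (rule partial_deriv_vanish[OF closed_cball Suc.prems(2) that])
  qed (use Suc.prems in auto)
  moreover have "\<bar>conv g K x\<bar> \<le> M * measure lborel (cball (0 :: real ^ 'n) 1)" for x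
    using Suc.prems dbound_0[OF Suc.prems(3)] Ck_on_continuous[OF Suc.prems(1)] by (intro abs_conv_le[OF g]) auto
  ultimately show ?case by simp
qed

section \<open>Cutoff functions\<close>

lemma lint_reflect_translate:
  fixes K :: "'a::euclidean_space \<Rightarrow> real"
  assumes "continuous_on UNIV K" "\<And>z. K (- z) = K z"
  shows "(LINT y|lborel. K (x - y)) = (LINT y|lborel. K y)"
proof -
  have "K (x - y) = K (- x + y)" for y using assms(2)[of "x - y"] by (simp add: algebra_simps)
  then show ?thesis
    using lint_translate[of K "- x"] assms(1) by (simp add: borel_measurable_continuous_onI)
qed

lemma bounded_infdist_le:
  fixes Z :: "'a::euclidean_space set"
  assumes "compact Z" "Z \<noteq> {}" shows "bounded {x. infdist x Z \<le> r}"
proof -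
  obtain B where B: "\<And>z. z \<in> Z \<Longrightarrow> norm z \<le> B" using compact_imp_bounded[OF assms(1)] by (auto simp: bounded_iff)
  have "norm y \<le> B + r" if "infdist y Z \<le> r" for y
  proof -
    obtain z where "z \<in> Z" "infdist y Z = dist y z"
      using infdist_attains_inf[OF compact_imp_closed[OF assms(1)] assms(2)] by blast
    then show ?thesis using B[of z] that norm_triangle_ineq2[of y z] by (auto simp: dist_norm)
  qed
  then show ?thesis unfolding bounded_iff by blast
qed

text \<open>The cutoff is a mollification at scale \<open>1\<close> of a continuous function of the distance to \<open>Z\<close> that
passes from \<open>1\<close> to \<open>0\<close> between the distances \<open>2\<close> and \<open>3\<close>. The constant \<open>M\<close> stands in front of the
quantifier over \<open>Z\<close>: the next lemma applies this to arbitrarily large dilates of one fixed set.\<close>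

lemma unit_cutoff:
  "\<exists>M\<ge>0. \<forall>Z. compact Z \<longrightarrow> Z \<noteq> {} \<longrightarrow> (\<exists>\<zeta> :: real ^ 'n::finite \<Rightarrow> real.
     Ck_on 4 UNIV \<zeta> \<and> dbound 4 (\<lambda>j x. M) \<zeta> \<and> (\<forall>x. 0 \<le> \<zeta> x \<and> \<zeta> x \<le> 1) \<and>
     (\<forall>x. infdist x Z \<le> 1 \<longrightarrow> \<zeta> x = 1) \<and> (\<forall>x. infdist x Z \<ge> 4 \<longrightarrow> \<zeta> x = 0))"
proof -
  define \<rho> :: "real ^ 'n \<Rightarrow> real" where "\<rho> = bump 5"
  have C\<rho>: "Ck_on 4 UNIV \<rho>" using Ck_on_bump[of 4] by (simp add: \<rho>_def)
  then have c\<rho>: "continuous_on UNIV \<rho>" by (rule Ck_on_continuous)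
  have \<rho>0: "\<rho> z = 0" if "z \<notin> cball 0 1" for z using that bump_vanish[of 5 z] by (simp add: \<rho>_def)
  have \<rho>p: "0 \<le> \<rho> z" for z by (simp add: \<rho>_def bump_bounds)
  have i\<rho>: "integrable lborel (\<lambda>y. \<rho> (x - y))" for x
    by (rule integrable_compact_support[of UNIV _ "cball x 1"])
      (auto simp: dist_norm norm_minus_commute intro!: \<rho>0 continuous_intros intro: continuous_on_compose2[OF c\<rho>])
  have i\<rho>': "integrable lborel \<rho>"
    by (rule integrable_compact_support[OF c\<rho>, of "cball 0 1"]) (auto intro: \<rho>0)
  \<comment> \<open>The mass of the kernel, by which the mollification has to be normalised.\<close>
  define c where "c = (LINT y|lborel. \<rho> y)"
  have c: "(LINT y|lborel. \<rho> (x - y)) = c" for x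
    unfolding c_def by (rule lint_reflect_translate[OF c\<rho>]) (simp add: \<rho>_def bump_def)
  have "(LINT y|lborel. (3/4) ^ 5 * indicator (cball (0 :: real ^ 'n) (1/2)) y) \<le> c"
    unfolding c_def
  proof (rule integral_mono[OF _ i\<rho>'])
    show "integrable lborel (\<lambda>y :: real ^ 'n. (3/4 :: real) ^ 5 * indicator (cball 0 (1/2)) y)"
      by (intro integrable_mult_right)
        (use emeasure_lborel_cball_finite[of "0 :: real ^ 'n" "1/2"] in \<open>auto intro!: integrable_real_indicator\<close>)
    show "(3/4) ^ 5 * indicator (cball 0 (1/2)) y \<le> \<rho> y" for y
      using bump_ge[of y 5] \<rho>p[of y] by (auto simp: indicator_def \<rho>_def)
  qed
  moreover have "(LINT y|lborel. (3/4) ^ 5 * indicator (cball (0 :: real ^ 'n) (1/2)) y)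
      = (3/4) ^ 5 * measure lborel (cball (0 :: real ^ 'n) (1/2))" by simp
  moreover have "0 < (3/4) ^ 5 * measure lborel (cball (0 :: real ^ 'n) (1/2))"
    by (intro mult_pos_pos) simp_all
  ultimately have cpos: "c > 0" by linarith
  obtain M where M: "M \<ge> 0" "dbound 4 (\<lambda>j x. M) \<rho>"
    using Ck_compact_support_dbound[OF C\<rho> compact_cball \<rho>0] by blast
  define M' where "M' = (1 / c) * (M * measure lborel (cball (0 :: real ^ 'n) 1))"
  have M': "M' \<ge> 0" using M(1) cpos by (simp add: M'_def)
  have "\<exists>\<zeta> :: real ^ 'n \<Rightarrow> real.
     Ck_on 4 UNIV \<zeta> \<and> dbound 4 (\<lambda>j x. 2 ^ 4 * M') \<zeta> \<and> (\<forall>x. 0 \<le> \<zeta> x \<and> \<zeta> x \<le> 1) \<and>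
     (\<forall>x. infdist x Z \<le> 1 \<longrightarrow> \<zeta> x = 1) \<and> (\<forall>x. infdist x Z \<ge> 4 \<longrightarrow> \<zeta> x = 0)"
    if Z: "compact Z" "Z \<noteq> {}" for Z
  proof -
    define g where "g = (\<lambda>y. max 0 (min 1 (3 - infdist y Z)))"
    have cg: "continuous_on UNIV g" unfolding g_def by (intro continuous_intros)
    have gb: "0 \<le> g y \<and> g y \<le> 1" for y by (auto simp: g_def)
    have "bounded {y. infdist y Z \<le> 3}" by (rule bounded_infdist_le[OF Z])
    then obtain a b where ab: "{y. infdist y Z \<le> 3} \<subseteq> cbox a b"
      using bounded_subset_cbox_symmetric by metis
    have g0: "g y = 0" if "y \<notin> cbox a b" for y
      using ab that by (force simp: g_def)
    define \<zeta> where "\<zeta> = (\<lambda>x. (1 / c) * conv g \<rho> x)"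
    have Cc: "Ck_on 4 UNIV (conv g \<rho>)" by (rule Ck_on_conv[OF cg g0 C\<rho>])
    have C\<zeta>: "Ck_on 4 UNIV \<zeta>" unfolding \<zeta>_def by (intro Ck_on_mult Ck_on_const Cc open_UNIV)
    have "dbound 4 (\<lambda>j x. 2 ^ j * M') \<zeta>"
      unfolding \<zeta>_def
      by (rule dbound_mult[OF Ck_on_const Cc dbound_const dbound_conv[OF cg g0 gb C\<rho> \<rho>0 M(2)]])
        (use cpos M(1) in \<open>auto simp: M'_def\<close>)
    then have d\<zeta>: "dbound 4 (\<lambda>j x. 2 ^ 4 * M') \<zeta>"
      by (rule dbound_mono) (intro mult_right_mono power_increasing M', auto)
    have ig: "integrable lborel (\<lambda>y. g y * \<rho> (x - y))" for x
      by (rule integrable_compact_support[of UNIV _ "cbox a b"])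
       (use g0 in \<open>auto intro!: continuous_intros intro: continuous_on_compose2[OF c\<rho>] continuous_on_subset[OF cg]\<close>)
    have "0 \<le> conv g \<rho> x" for x
      unfolding conv_def by (intro integral_nonneg_AE AE_I2 mult_nonneg_nonneg) (use gb \<rho>p in auto)
    moreover have "conv g \<rho> x \<le> c" for x
      unfolding conv_def c[of x, symmetric]
      by (rule integral_mono[OF ig i\<rho>]) (use gb \<rho>p in \<open>auto intro!: mult_left_le_one_le\<close>)
    ultimately have b\<zeta>: "0 \<le> \<zeta> x \<and> \<zeta> x \<le> 1" for x
      using cpos by (auto simp: \<zeta>_def)
    have inf1: "infdist y Z \<le> infdist x Z + dist x y" "infdist x Z \<le> infdist y Z + dist x y" for x y
      using infdist_triangle[of y Z x] infdist_triangle[of x Z y] by (auto simp: dist_commute)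
    have "\<zeta> x = 1" if "infdist x Z \<le> 1" for x
    proof -
      have "g y * \<rho> (x - y) = \<rho> (x - y)" for y
        using inf1(1)[of y x] that \<rho>0[of "x - y"]
        by (cases "norm (x - y) \<le> 1") (auto simp: g_def dist_norm norm_minus_commute max_def min_def)
      then have "conv g \<rho> x = c" unfolding conv_def by (simp only: c)
      then show ?thesis using cpos by (simp add: \<zeta>_def)
    qed
    moreover have "\<zeta> x = 0" if "infdist x Z \<ge> 4" for x
    proof -
      have "g y * \<rho> (x - y) = 0" for y
        using inf1(2)[of x y] that \<rho>0[of "x - y"]
        by (cases "norm (x - y) \<le> 1") (auto simp: g_def dist_norm norm_minus_commute max_def min_def)
      then have "conv g \<rho> x = 0" unfolding conv_def by (simp only: integral_zero)
      then show ?thesis by (simp add: \<zeta>_def)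
    qed
    ultimately show ?thesis using C\<zeta> d\<zeta> b\<zeta> by blast
  qed
  then show ?thesis using M' by (intro exI[of _ "2 ^ 4 * M'"]) auto
qed

text \<open>Dilating by \<open>1 / \<epsilon>\<close> turns the cutoff at scale \<open>1\<close> into one at scale \<open>\<epsilon>\<close>; each derivative costs a
factor \<open>1 / \<epsilon>\<close>. Beyond distance \<open>4 * \<epsilon>\<close> the function is locally zero, and so are its derivatives.\<close>

lemma cutoff:
  "\<exists>M\<ge>0. \<forall>Z \<epsilon>. compact Z \<longrightarrow> Z \<noteq> {} \<longrightarrow> \<epsilon> > 0 \<longrightarrow> (\<exists>\<zeta> :: real ^ 'n::finite \<Rightarrow> real.
     Ck_on 4 UNIV \<zeta> \<and> dbound 4 (\<lambda>j x. if infdist x Z \<le> 4 * \<epsilon> then M * (1 / \<epsilon>) ^ j else 0) \<zeta> \<and>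
     (\<forall>x. 0 \<le> \<zeta> x \<and> \<zeta> x \<le> 1) \<and>
     (\<forall>x. infdist x Z \<le> \<epsilon> \<longrightarrow> \<zeta> x = 1) \<and> (\<forall>x. infdist x Z \<ge> 4 * \<epsilon> \<longrightarrow> \<zeta> x = 0))"
proof -
  obtain M where M: "M \<ge> 0" and ex: "\<And>Z. compact Z \<Longrightarrow> Z \<noteq> {} \<Longrightarrow> (\<exists>\<zeta> :: real ^ 'n \<Rightarrow> real.
     Ck_on 4 UNIV \<zeta> \<and> dbound 4 (\<lambda>j x. M) \<zeta> \<and> (\<forall>x. 0 \<le> \<zeta> x \<and> \<zeta> x \<le> 1) \<and>
     (\<forall>x. infdist x Z \<le> 1 \<longrightarrow> \<zeta> x = 1) \<and> (\<forall>x. infdist x Z \<ge> 4 \<longrightarrow> \<zeta> x = 0))"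
    using unit_cutoff by blast
  have "\<exists>\<zeta> :: real ^ 'n \<Rightarrow> real.
     Ck_on 4 UNIV \<zeta> \<and> dbound 4 (\<lambda>j x. if infdist x Z \<le> 4 * \<epsilon> then M * (1 / \<epsilon>) ^ j else 0) \<zeta> \<and>
     (\<forall>x. 0 \<le> \<zeta> x \<and> \<zeta> x \<le> 1) \<and>
     (\<forall>x. infdist x Z \<le> \<epsilon> \<longrightarrow> \<zeta> x = 1) \<and> (\<forall>x. infdist x Z \<ge> 4 * \<epsilon> \<longrightarrow> \<zeta> x = 0)"
    if Z: "compact Z" "Z \<noteq> {}" "\<epsilon> > 0" for Z and \<epsilon> :: real
  proof -
    define Z' where "Z' = (\<lambda>z. (1 / \<epsilon>) *\<^sub>R z) ` Z"
    have Z': "compact Z'" "Z' \<noteq> {}" using Z by (auto simp: Z'_def intro: compact_scaling)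
    obtain \<eta> where \<eta>: "Ck_on 4 UNIV \<eta>" "dbound 4 (\<lambda>j x. M) \<eta>" "\<And>x. 0 \<le> \<eta> x \<and> \<eta> x \<le> 1"
      "\<And>x. infdist x Z' \<le> 1 \<Longrightarrow> \<eta> x = 1" "\<And>x. infdist x Z' \<ge> 4 \<Longrightarrow> \<eta> x = 0"
      using ex[OF Z'] by blast
    have ds: "dist ((1 / \<epsilon>) *\<^sub>R x) ((1 / \<epsilon>) *\<^sub>R z) = dist x z / \<epsilon>" for x z :: "real ^ 'n"
      using Z(3) unfolding dist_norm scaleR_diff_right[symmetric] by simp
    have i1: "infdist ((1 / \<epsilon>) *\<^sub>R x) Z' \<le> 1" if "infdist x Z \<le> \<epsilon>" for x
    proof -
      obtain z where "z \<in> Z" "infdist x Z = dist x z"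
        using infdist_attains_inf[OF compact_imp_closed[OF Z(1)] Z(2)] by blast
      then have "(1 / \<epsilon>) *\<^sub>R z \<in> Z'" "dist ((1 / \<epsilon>) *\<^sub>R x) ((1 / \<epsilon>) *\<^sub>R z) \<le> 1"
        using that Z(3) by (auto simp: Z'_def ds)
      then show ?thesis by (meson infdist_le2)
    qed
    have i4: "infdist ((1 / \<epsilon>) *\<^sub>R x) Z' \<ge> 4" if "infdist x Z \<ge> 4 * \<epsilon>" for x
    proof -
      obtain z where "z \<in> Z" "infdist ((1 / \<epsilon>) *\<^sub>R x) Z' = dist ((1 / \<epsilon>) *\<^sub>R x) ((1 / \<epsilon>) *\<^sub>R z)"
        using infdist_attains_inf[OF compact_imp_closed[OF Z'(1)] Z'(2), of "(1 / \<epsilon>) *\<^sub>R x"]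
        by (auto simp: Z'_def)
      moreover have "4 \<le> dist x z / \<epsilon>"
        using infdist_le[OF \<open>z \<in> Z\<close>, of x] that Z(3) by (simp add: pos_le_divide_eq)
      ultimately show ?thesis by (simp add: ds)
    qed
    define \<zeta> where "\<zeta> = (\<lambda>x. \<eta> ((1 / \<epsilon>) *\<^sub>R x))"
    have "dbound 4 (\<lambda>j x. M * (1 / \<epsilon>) ^ j) \<zeta>"
      unfolding \<zeta>_def by (rule dbound_mono[OF dbound_scale[OF \<eta>(1,2)]]) (use Z(3) in simp)
    then have "dbound 4 (\<lambda>j x. if x \<in> {x. infdist x Z \<le> 4 * \<epsilon>} then M * (1 / \<epsilon>) ^ j else 0) \<zeta>"
    proof (rule dbound_vanish[rotated 2])
      show "closed {x. infdist x Z \<le> 4 * \<epsilon>}" by (intro closed_Collect_le continuous_intros)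
      show "\<zeta> x = 0" if "x \<notin> {x. infdist x Z \<le> 4 * \<epsilon>}" for x
        using that i4[of x] \<eta>(5) by (simp add: \<zeta>_def)
    qed
    moreover have "Ck_on 4 UNIV \<zeta>" unfolding \<zeta>_def by (rule Ck_on_compose_scale[OF \<eta>(1)])
    ultimately show ?thesis using \<eta>(3-5) i1 i4 by (intro exI[of _ \<zeta>]) (auto simp: \<zeta>_def)
  qed
  then show ?thesis using M by blast
qed

section \<open>Integration by parts\<close>

lemma partial_deriv_along_line:
  assumes "Ck_on (Suc k) UNIV F"
  shows "((\<lambda>t. F (t *\<^sub>R axis i 1 + x)) has_real_derivative partial_deriv i F (t *\<^sub>R axis i 1 + x)) (at t)"
proof -
  let ?y = "t *\<^sub>R axis i 1 + x"
  have "((\<lambda>t. F (t *\<^sub>R axis i 1 + x)) has_derivative (\<lambda>s. frechet_derivative F (at ?y) (s *\<^sub>R axis i 1))) (at t)"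
    by (rule has_derivative_compose[of "\<lambda>t. t *\<^sub>R axis i 1 + x", OF _ Ck_on_has_derivative[OF assms UNIV_I]])
      (auto intro!: derivative_eq_intros)
  moreover have "linear (frechet_derivative F (at ?y))"
    using assms by (auto intro: linear_frechet_derivative)
  ultimately show ?thesis
    by (simp add: has_field_derivative_def partial_deriv_def linear_cmul mult_commute_abs)
qed

text \<open>The integral is translation invariant, so every difference quotient of \<open>F\<close> has integral zero. By the
mean value theorem the difference quotients are bounded by a constant on a fixed ball and vanish
outside it; dominated convergence carries the identity over to the derivative.\<close>

lemma lint_partial_deriv_eq_0:
  fixes F :: "real ^ 'n::finite \<Rightarrow> real"
  assumes F: "Ck_on (Suc 0) UNIV F" and K: "compact K" "\<And>x. x \<notin> K \<Longrightarrow> F x = 0"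
  shows "(LINT x|lborel. partial_deriv i F x) = 0"
proof -
  define e where "e = (axis i 1 :: real ^ 'n)"
  define h where "h = (\<lambda>n. 1 / real (Suc n))"
  have h: "0 < h n" "h n \<le> 1" for n by (auto simp: h_def)
  have cF: "continuous_on UNIV F" by (rule Ck_on_continuous[OF F])
  have iF: "integrable lborel F" by (rule integrable_compact_support[OF cF K(1)]) (use K(2) in auto)
  have mF: "F \<in> borel_measurable borel" by (rule borel_measurable_continuous_onI[OF cF])
  obtain M where M: "M \<ge> 0" "dbound (Suc 0) (\<lambda>j x. M) F" using Ck_compact_support_dbound[OF F K] by blast
  have M': "\<bar>partial_deriv i F x\<bar> \<le> M" for x using M(2) by simp
  obtain R where R: "\<And>x. x \<in> K \<Longrightarrow> norm x \<le> R" using compact_imp_bounded[OF K(1)] by (auto simp: bounded_iff)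
  define s where "s = (\<lambda>n x. (F (h n *\<^sub>R e + x) - F x) / h n)"
  have "(\<lambda>n. LINT x|lborel. s n x) \<longlonglongrightarrow> (LINT x|lborel. partial_deriv i F x)"
  proof (rule integral_dominated_convergence[where w="\<lambda>x. M * indicator (cball 0 (R + 1)) x"])
    show "partial_deriv i F \<in> borel_measurable lborel"
      using Ck_on_continuous[OF Ck_on_partial_deriv[OF F]] borel_measurable_continuous_onI by auto
    have "(\<lambda>x. F (h n *\<^sub>R e + x)) \<in> borel_measurable borel" for n
      by (intro borel_measurable_continuous_onI continuous_on_compose2[OF cF]) (auto intro!: continuous_intros)
    then show "s n \<in> borel_measurable lborel" for n
      using mF unfolding s_def by (intro borel_measurable_divide borel_measurable_diff) auto
    show "integrable lborel (\<lambda>x :: real ^ 'n. M * indicator (cball 0 (R + 1)) x)"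
      by (intro integrable_mult_right)
        (use emeasure_lborel_cball_finite[of "0 :: real ^ 'n" "R + 1"] in \<open>auto intro!: integrable_real_indicator\<close>)
    show "AE x in lborel. (\<lambda>n. s n x) \<longlonglongrightarrow> partial_deriv i F x"
    proof (rule AE_I2)
      fix x
      have "((\<lambda>t. (F (t *\<^sub>R e + x) - F x) / t) \<longlongrightarrow> partial_deriv i F x) (at 0)"
        using partial_deriv_along_line[OF F, of i x 0] by (simp add: DERIV_def e_def)
      moreover have "filterlim h (at 0) sequentially"
        unfolding h_def by (rule filterlim_atI) (use LIMSEQ_inverse_real_of_nat in \<open>auto simp: inverse_eq_divide\<close>)
      ultimately show "(\<lambda>n. s n x) \<longlonglongrightarrow> partial_deriv i F x"
        unfolding s_def by (rule filterlim_compose)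
    qed
    show "AE x in lborel. norm (s n x) \<le> M * indicator (cball 0 (R + 1)) x" for n
    proof (rule AE_I2)
      fix x
      show "norm (s n x) \<le> M * indicator (cball 0 (R + 1)) x"
      proof (cases "norm x \<le> R + 1")
        case True
        obtain z where "F (h n *\<^sub>R e + x) - F (0 *\<^sub>R e + x) = (h n - 0) * partial_deriv i F (z *\<^sub>R e + x)"
          using MVT2[OF h(1)[of n], of "\<lambda>t. F (t *\<^sub>R e + x)" "\<lambda>t. partial_deriv i F (t *\<^sub>R e + x)"]
            partial_deriv_along_line[OF F, of i x] unfolding e_def by blast
        then have "s n x = partial_deriv i F (z *\<^sub>R e + x)" using h(1)[of n] by (simp add: s_def)
        then show ?thesis using M' True by simp
      next
        case False
        have "norm (h n *\<^sub>R e + x) \<ge> norm x - norm (h n *\<^sub>R e)"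
          by (metis add.commute norm_diff_ineq)
        moreover have "norm (h n *\<^sub>R e) \<le> 1" using h[of n] by (simp add: e_def)
        ultimately have "norm (h n *\<^sub>R e + x) > R" using False by linarith
        then have "F (h n *\<^sub>R e + x) = 0" "F x = 0" using False R K(2) by force+
        then show ?thesis using False by (simp add: s_def)
      qed
    qed
  qed
  moreover have "(LINT x|lborel. s n x) = 0" for n
  proof -
    have "integrable lborel (\<lambda>x. F (h n *\<^sub>R e + x))"
    proof (rule integrable_compact_support[of UNIV _ "(\<lambda>x. x - h n *\<^sub>R e) ` K"])
      show "compact ((\<lambda>x. x - h n *\<^sub>R e) ` K)"
        using K(1) by (intro compact_continuous_image continuous_intros)
      show "F (h n *\<^sub>R e + x) = 0" if "x \<notin> (\<lambda>x. x - h n *\<^sub>R e) ` K" for x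
        using that K(2)[of "h n *\<^sub>R e + x"] by (force simp: image_iff)
    qed (auto intro!: continuous_on_compose2[OF cF] continuous_intros)
    then show ?thesis using iF lint_translate[OF mF, of "h n *\<^sub>R e"] by (simp add: s_def)
  qed
  ultimately show ?thesis by (simp add: LIMSEQ_const_iff)
qed

lemma Ck_on_Un:
  assumes "open S" "open T" "Ck_on k S f" "Ck_on k T f" shows "Ck_on k (S \<union> T) f"
  using assms(3,4) by (induction k arbitrary: f) (auto intro: continuous_on_open_Un assms(1,2))

text \<open>Values of \<open>G\<close> outside \<open>U\<close>, however wild, are annihilated by a factor that vanishes near them.\<close>

lemma Ck_on_mult_extend:
  fixes G \<xi> :: "'a::real_normed_vector \<Rightarrow> real"
  assumes "open U" "closed K" "K \<subseteq> U" "Ck_on k U G" "Ck_on k UNIV \<xi>" "\<And>x. x \<notin> K \<Longrightarrow> \<xi> x = 0"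
  shows "Ck_on k UNIV (\<lambda>x. G x * \<xi> x)"
proof -
  have "Ck_on k U (\<lambda>x. G x * \<xi> x)" by (intro Ck_on_mult assms Ck_on_subset[OF assms(5)]) auto
  moreover have "Ck_on k (- K) (\<lambda>x. G x * \<xi> x)"
    by (rule Ck_on_cong[of _ "\<lambda>x. 0"]) (use assms in \<open>auto intro: Ck_on_const\<close>)
  ultimately have "Ck_on k (U \<union> - K) (\<lambda>x. G x * \<xi> x)" using assms by (intro Ck_on_Un) auto
  moreover have "U \<union> - K = UNIV" using assms(3) by auto
  ultimately show ?thesis by simp
qed

lemma integrable_mult_compact_support:
  fixes G \<xi> :: "'a::euclidean_space \<Rightarrow> real"
  assumes "continuous_on U G" "compact K" "K \<subseteq> U" "continuous_on UNIV \<xi>" "\<And>x. x \<notin> K \<Longrightarrow> \<xi> x = 0"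
  shows "integrable lborel (\<lambda>x. G x * \<xi> x)"
  by (rule integrable_compact_support[of U _ K])
    (use assms in \<open>auto intro!: continuous_intros intro: continuous_on_subset\<close>)

lemma integration_by_parts:
  fixes G \<xi> :: "real ^ 'n::finite \<Rightarrow> real"
  assumes U: "open U" and K: "compact K" "K \<subseteq> U" and G: "Ck_on (Suc 0) U G"
    and \<xi>: "Ck_on (Suc 0) UNIV \<xi>" "\<And>x. x \<notin> K \<Longrightarrow> \<xi> x = 0"
  shows "(LINT x|lborel. partial_deriv i G x * \<xi> x) = - (LINT x|lborel. G x * partial_deriv i \<xi> x)"
proof -
  have \<xi>': "partial_deriv i \<xi> x = 0" if "x \<notin> K" for x
    by (rule partial_deriv_vanish[OF compact_imp_closed[OF K(1)] \<xi>(2) that])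
  have int: "integrable lborel (\<lambda>x. G x * partial_deriv i \<xi> x)" "integrable lborel (\<lambda>x. partial_deriv i G x * \<xi> x)"
    using Ck_on_continuous[OF G] Ck_on_continuous[OF \<xi>(1)] Ck_on_continuous[OF Ck_on_partial_deriv[OF G]]
       Ck_on_continuous[OF Ck_on_partial_deriv[OF \<xi>(1)]] \<xi>(2) \<xi>' K
    by (auto intro!: integrable_mult_compact_support[where U=U and K=K])
  have F: "Ck_on (Suc 0) UNIV (\<lambda>x. G x * \<xi> x)"
    by (rule Ck_on_mult_extend[OF U compact_imp_closed[OF K(1)] K(2) G \<xi>])
  have "partial_deriv i (\<lambda>x. G x * \<xi> x) x = G x * partial_deriv i \<xi> x + partial_deriv i G x * \<xi> x" for x
  proof (cases "x \<in> U")
    case True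
    from partial_derivI[OF has_derivative_mult[OF Ck_on_has_derivative[OF G True] Ck_on_has_derivative[OF \<xi>(1) UNIV_I]]]
    show ?thesis by (simp add: partial_deriv_def)
  next
    case False
    then have "x \<notin> K" using K(2) by auto
    then show ?thesis
      using partial_deriv_vanish[OF compact_imp_closed[OF K(1)], of "\<lambda>x. G x * \<xi> x" x] \<xi>(2) \<xi>' by simp
  qed
  moreover have "(LINT x|lborel. partial_deriv i (\<lambda>x. G x * \<xi> x) x) = 0"
    by (rule lint_partial_deriv_eq_0[OF F K(1)]) (simp add: \<xi>(2))
  ultimately show ?thesis using int by simp
qed

lemma integration_by_parts_laplacian:
  fixes G \<xi> :: "real ^ 'n::finite \<Rightarrow> real"
  assumes U: "open U" and K: "compact K" "K \<subseteq> U" and G: "Ck_on (Suc (Suc 0)) U G"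
    and \<xi>: "Ck_on (Suc (Suc 0)) UNIV \<xi>" "\<And>x. x \<notin> K \<Longrightarrow> \<xi> x = 0"
  shows "(LINT x|lborel. laplacian G x * \<xi> x) = (LINT x|lborel. G x * laplacian \<xi> x)"
proof -
  have \<xi>': "partial_deriv i \<xi> x = 0" if "x \<notin> K" for x i
    by (rule partial_deriv_vanish[OF compact_imp_closed[OF K(1)] \<xi>(2) that])
  have \<xi>'': "partial_deriv i (partial_deriv i \<xi>) x = 0" if "x \<notin> K" for x i
    by (rule partial_deriv_vanish[OF compact_imp_closed[OF K(1)] \<xi>' that])
  note C = Ck_on_partial_deriv[OF G] Ck_on_partial_deriv[OF \<xi>(1)]
  have G1: "Ck_on (Suc 0) U G" and \<xi>1: "Ck_on (Suc 0) UNIV \<xi>"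
    using Ck_on_lower[OF G, of "Suc 0"] Ck_on_lower[OF \<xi>(1), of "Suc 0"] by auto
  have int: "integrable lborel (\<lambda>x. G x * partial_deriv i (partial_deriv i \<xi>) x)"
    "integrable lborel (\<lambda>x. partial_deriv i (partial_deriv i G) x * \<xi> x)" for i
    using Ck_on_continuous[OF G] Ck_on_continuous[OF \<xi>(1)] Ck_on_continuous[OF Ck_on_partial_deriv[OF C(1)]]
       Ck_on_continuous[OF Ck_on_partial_deriv[OF C(2)]] \<xi>(2) \<xi>'' K
    by (auto intro!: integrable_mult_compact_support[where U=U and K=K])
  have "(LINT x|lborel. partial_deriv i (partial_deriv i G) x * \<xi> x)
     = (LINT x|lborel. G x * partial_deriv i (partial_deriv i \<xi>) x)" for i
    using integration_by_parts[OF U K C(1) \<xi>1 \<xi>(2), of i i]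
      integration_by_parts[OF U K G1 C(2) \<xi>', of i i] by simp
  then show ?thesis
    unfolding laplacian_def using int by (simp add: sum_distrib_left sum_distrib_right)
qed

text \<open>Laplacians are moved one at a time, so that no commutation of partial derivatives is involved.\<close>

lemma integration_by_parts_bilaplacian:
  fixes G \<xi> :: "real ^ 'n::finite \<Rightarrow> real"
  assumes U: "open U" and K: "compact K" "K \<subseteq> U" and G: "Ck_on 4 U G"
    and \<xi>: "Ck_on 4 UNIV \<xi>" "\<And>x. x \<notin> K \<Longrightarrow> \<xi> x = 0"
  shows "(LINT x|lborel. bilaplacian G x * \<xi> x) = (LINT x|lborel. G x * bilaplacian \<xi> x)"
proof -
  have 4: "(4::nat) = Suc (Suc (Suc (Suc 0)))" by simp
  have C: "Ck_on (Suc (Suc 0)) U (laplacian G)" "Ck_on (Suc (Suc 0)) UNIV (laplacian \<xi>)"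
    using G \<xi>(1) U unfolding 4 by (auto intro!: Ck_on_laplacian simp del: Ck_on.simps)
  have l: "Ck_on (Suc (Suc 0)) U G" "Ck_on (Suc (Suc 0)) UNIV \<xi>"
    using Ck_on_lower[OF G, of "Suc (Suc 0)"] Ck_on_lower[OF \<xi>(1), of "Suc (Suc 0)"] by auto
  have "laplacian \<xi> x = 0" if "x \<notin> K" for x
    by (rule laplacian_vanish[OF compact_imp_closed[OF K(1)] \<xi>(2) that])
  then show ?thesis
    unfolding bilaplacian_def
    using integration_by_parts_laplacian[OF U K C(1) l(2) \<xi>(2)] integration_by_parts_laplacian[OF U K l(1) C(2)]
    by simp
qed

section \<open>Test functions that vanish near the singular set\<close>

lemma dbound_replace_0:
  assumes "dbound k B f" "\<And>x. \<bar>f x\<bar> \<le> B0 x"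
  shows "dbound k (\<lambda>j x. if j = 0 then B0 x else B j x) f"
  using assms by (cases k) auto

text \<open>Each differentiation of \<open>h ^ m\<close> costs a factor \<open>w\<close> and lowers the power of \<open>h\<close> by at most one. The
subtraction on natural numbers is truncated on purpose: once the power is used up, \<open>h ^ 0 = 1\<close>
remains, and \<open>(1 - i) + (m - j) \<ge> (m + 1) - (i + j)\<close> holds for all \<open>i\<close> and \<open>j\<close>. The surviving
power \<open>h ^ (m - 4)\<close> in the bilaplacian is what lets the nonlinear term absorb the error.\<close>

lemma dbound_power:
  fixes h :: "real ^ 'n::finite \<Rightarrow> real"
  assumes C: "Ck_on 4 UNIV h" and h: "\<And>x. 0 \<le> h x" "\<And>x. h x \<le> 1" and w: "\<And>x. 0 \<le> w x"
    and c: "1 \<le> c" and B: "dbound 4 (\<lambda>j x. c * w x ^ j * h x ^ (1 - j)) h"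
  shows "dbound 4 (\<lambda>j x. (16 * c) ^ m * w x ^ j * h x ^ (m - j)) (\<lambda>x. h x ^ m)"
proof (induction m)
  case 0
  show ?case by simp (rule dbound_mono[OF dbound_const], use w in auto)
next
  case (Suc m)
  have "dbound 4 (\<lambda>j x. 2 ^ j * (c * (16 * c) ^ m * w x ^ j * h x ^ (Suc m - j))) (\<lambda>x. h x * h x ^ m)"
  proof (rule dbound_mult[OF C Ck_on_power[OF open_UNIV C] B Suc.IH])
    fix i j :: nat and x
    have "h x ^ (1 - i) * h x ^ (m - j) \<le> h x ^ (Suc m - (i + j))"
      unfolding power_add[symmetric] using h by (intro power_decreasing) auto
    then have "(c * (16 * c) ^ m * w x ^ (i + j)) * (h x ^ (1 - i) * h x ^ (m - j))
        \<le> (c * (16 * c) ^ m * w x ^ (i + j)) * h x ^ (Suc m - (i + j))"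
      using c w by (intro mult_left_mono) auto
    then show "c * w x ^ i * h x ^ (1 - i) * ((16 * c) ^ m * w x ^ j * h x ^ (m - j))
        \<le> c * (16 * c) ^ m * w x ^ (i + j) * h x ^ (Suc m - (i + j))"
      by (simp add: power_add mult_ac)
  qed
  then show ?case
  proof (simp only: power_Suc, rule dbound_mono)
    fix j :: nat and x assume "j \<le> 4"
    then have "(2::real) ^ j \<le> 2 ^ 4" by (intro power_increasing) auto
    then have "2 ^ j * (c * (16 * c) ^ m * w x ^ j * h x ^ (Suc m - j)) \<le> 16 * (c * (16 * c) ^ m * w x ^ j * h x ^ (Suc m - j))"
      using c w h by (intro mult_right_mono) auto
    then show "2 ^ j * (c * (16 * c) ^ m * w x ^ j * h x ^ (Suc m - j)) \<le> 16 * c * (16 * c) ^ m * w x ^ j * h x ^ (Suc m - j)"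
      by (simp add: mult_ac)
  qed
qed

lemma Youngs_inequality':
  fixes a b p :: real
  assumes "p > 1" "a \<ge> 0" "b \<ge> 0"
  shows "a * b \<le> a powr p / p + b powr (p / (p - 1)) / (p / (p - 1))"
  by (rule Youngs_inequality) (use assms in \<open>auto simp: field_simps\<close>)

text \<open>The geometry of \<open>Z\<close> enters only through the volume of its neighbourhoods. The exponent \<open>4 * q\<close>,
with \<open>q\<close> conjugate to \<open>p\<close>, is the critical one: \<open>(1 / r) ^ 4\<close> is the size of the bilaplacian of a
cutoff at scale \<open>r\<close>, and its \<open>L^q\<close> norm over the \<open>r\<close>-neighbourhood stays bounded.\<close>

locale punctured_problem =
  fixes u :: "real ^ 'n::finite \<Rightarrow> real" and Z :: "(real ^ 'n) set" and p q C r0 :: real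
  assumes Z: "compact Z" "Z \<noteq> {}"
    and p: "p > 1" and q_def: "q = p / (p - 1)"
    and r0: "r0 > 0"
    and nbhd: "\<And>r. 0 < r \<Longrightarrow> r < r0 \<Longrightarrow> measure lborel {x. infdist x Z \<le> r} \<le> C * r powr (4 * q)"
    and sol: "punctured_solution p Z u" and pos: "\<And>x. x \<notin> Z \<Longrightarrow> u x > 0"
begin

text \<open>The values of \<open>u\<close> on \<open>Z\<close> are arbitrary. Replacing them by \<open>0\<close> gives a Borel function, which agrees
with \<open>u\<close> almost everywhere because \<open>Z\<close> is a null set.\<close>

definition v :: "real ^ 'n \<Rightarrow> real" where "v x = (if x \<in> Z then 0 else u x)"

lemma q: "q > 1" using p by (simp add: q_def)

lemma closed_Z: "closed Z" using Z(1) by (rule compact_imp_closed)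

lemma v_nonneg: "0 \<le> v x" using pos[of x] by (auto simp: v_def)

lemma u_C4: "Ck_on 4 (- Z) u" using sol by (simp add: punctured_solution_def)

lemma v_measurable [measurable]: "v \<in> borel_measurable borel"
proof -
  have "(\<lambda>x. indicator (- Z) x *\<^sub>R u x) \<in> borel_measurable borel"
    using Ck_on_continuous[OF u_C4] closed_Z by (intro borel_measurable_continuous_on_indicator) auto
  moreover have "(\<lambda>x. indicator (- Z) x *\<^sub>R u x) = v" by (auto simp: v_def fun_eq_iff)
  ultimately show ?thesis by simp
qed

lemma closed_nbhd: "closed {x. infdist x Z \<le> r}"
  by (intro closed_Collect_le continuous_intros)

lemma compact_nbhd: "compact {x. infdist x Z \<le> r}"
  using closed_nbhd bounded_infdist_le[OF Z] by (simp add: compact_eq_bounded_closed)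

lemma infdist_pos: "x \<notin> Z \<Longrightarrow> infdist x Z > 0"
  using closed_Z Z(2) by (simp add: infdist_pos_not_in_closed)

text \<open>\<open>Z\<close> lies in all of its neighbourhoods, whose volumes tend to zero.\<close>

lemma null_Z: "Z \<in> null_sets lborel"
proof -
  have "measure lborel Z \<le> C * r powr (4 * q)" if "0 < r" "r < r0" for r
  proof -
    have "measure lborel Z \<le> measure lborel {x. infdist x Z \<le> r}"
      using that compact_nbhd[of r] closed_Z
      by (intro measure_mono_fmeasurable) (auto intro: fmeasurable_compact)
    then show ?thesis using nbhd[OF that] by linarith
  qed
  then have "\<forall>\<^sub>F r in at_right 0. measure lborel Z \<le> C * r powr (4 * q)"
    using r0 by (auto simp: eventually_at_right_field)
  moreover have "((\<lambda>r. C * r powr (4 * q)) \<longlongrightarrow> C * 0) (at_right 0)"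
    using q by (intro tendsto_intros tendsto_zero_powrI)
      (auto intro!: tendsto_eq_intros eventually_mono[OF eventually_at_right_less[of 0]])
  ultimately have "measure lborel Z \<le> 0"
    by (intro tendsto_lowerbound[where F="at_right 0" and f="\<lambda>r. C * r powr (4 * q)"]) auto
  then have "measure lborel Z = 0" by (simp add: order.antisym)
  moreover have "Z \<in> fmeasurable lborel" using Z(1) by (rule fmeasurable_compact)
  ultimately show ?thesis
    using emeasure_eq_measure2[of Z lborel] by (auto simp: null_sets_def fmeasurable_def)
qed

lemma weak_formulation:
  assumes K: "compact K" "K \<subseteq> - Z" and \<xi>: "Ck_on 4 UNIV \<xi>" "\<And>x. x \<notin> K \<Longrightarrow> \<xi> x = 0"
  shows "integrable lborel (\<lambda>x. v x powr p * \<xi> x)" "integrable lborel (\<lambda>x. v x * bilaplacian \<xi> x)"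
    "(LINT x|lborel. v x powr p * \<xi> x) = (LINT x|lborel. v x * bilaplacian \<xi> x)"
proof -
  have U: "open (- Z)" using closed_Z by auto
  have b0: "bilaplacian \<xi> x = 0" if "x \<notin> K" for x
    by (rule bilaplacian_vanish[OF compact_imp_closed[OF K(1)] \<xi>(2) that])
  have e1: "(\<lambda>x. v x powr p * \<xi> x) = (\<lambda>x. bilaplacian u x * \<xi> x)"
    using sol K(2) \<xi>(2) by (auto simp: v_def punctured_solution_def fun_eq_iff)
  have e2: "(\<lambda>x. v x * bilaplacian \<xi> x) = (\<lambda>x. u x * bilaplacian \<xi> x)"
    using K(2) b0 by (auto simp: v_def fun_eq_iff)
  have 4: "(4::nat) = Suc (Suc (Suc (Suc 0)))" by simp
  have "Ck_on 0 (- Z) (bilaplacian u)" "Ck_on 0 UNIV (bilaplacian \<xi>)"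
    unfolding bilaplacian_def using u_C4 \<xi>(1) U unfolding 4
    by (auto intro!: Ck_on_laplacian simp del: Ck_on.simps)
  then have "continuous_on (- Z) (bilaplacian u)" "continuous_on UNIV (bilaplacian \<xi>)" by auto
  then show "integrable lborel (\<lambda>x. v x powr p * \<xi> x)" "integrable lborel (\<lambda>x. v x * bilaplacian \<xi> x)"
    unfolding e1 e2 using Ck_on_continuous[OF u_C4] Ck_on_continuous[OF \<xi>(1)] \<xi>(2) b0
    by (auto intro!: integrable_mult_compact_support[where U="-Z" and K=K] K)
  show "(LINT x|lborel. v x powr p * \<xi> x) = (LINT x|lborel. v x * bilaplacian \<xi> x)"
    unfolding e1 e2 by (rule integration_by_parts_bilaplacian[OF U K u_C4 \<xi>])
qed

text \<open>The cost of one differentiation of a function that is cut off near \<open>Z\<close> at scale \<open>\<epsilon>\<close>.\<close>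

definition wt :: "real \<Rightarrow> real ^ 'n \<Rightarrow> real" where
  "wt \<epsilon> x = (if infdist x Z \<le> 4 * \<epsilon> then 1 / \<epsilon> else 1)"

lemma wt_ge_1: "0 < \<epsilon> \<Longrightarrow> \<epsilon> \<le> 1 \<Longrightarrow> 1 \<le> wt \<epsilon> x"
  by (auto simp: wt_def)

text \<open>The point is that \<open>c\<close> does not depend on \<open>\<epsilon>\<close>: away from \<open>Z\<close> the product is \<open>\<psi>\<close> itself, and near
\<open>Z\<close> the derivatives of the cutoff dominate.\<close>

lemma cutoff_times:
  assumes \<psi>: "Ck_on 4 UNIV \<psi>" "compact K" "\<And>x. x \<notin> K \<Longrightarrow> \<psi> x = 0"
  shows "\<exists>c\<ge>1. \<forall>\<epsilon>. 0 < \<epsilon> \<longrightarrow> \<epsilon> \<le> 1 \<longrightarrow> (\<exists>\<zeta>. Ck_on 4 UNIV (\<lambda>x. (1 - \<zeta> x) * \<psi> x) \<and>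
     dbound 4 (\<lambda>j x. c * wt \<epsilon> x ^ j) (\<lambda>x. (1 - \<zeta> x) * \<psi> x) \<and>
     (\<forall>x. 0 \<le> \<zeta> x \<and> \<zeta> x \<le> 1) \<and>
     (\<forall>x. infdist x Z \<le> \<epsilon> \<longrightarrow> \<zeta> x = 1) \<and> (\<forall>x. infdist x Z \<ge> 4 * \<epsilon> \<longrightarrow> \<zeta> x = 0))"
proof -
  obtain M where M: "M \<ge> 0" and ex: "\<And>\<epsilon>. \<epsilon> > 0 \<Longrightarrow> (\<exists>\<zeta> :: real ^ 'n \<Rightarrow> real.
     Ck_on 4 UNIV \<zeta> \<and> dbound 4 (\<lambda>j x. if infdist x Z \<le> 4 * \<epsilon> then M * (1 / \<epsilon>) ^ j else 0) \<zeta> \<and>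
     (\<forall>x. 0 \<le> \<zeta> x \<and> \<zeta> x \<le> 1) \<and>
     (\<forall>x. infdist x Z \<le> \<epsilon> \<longrightarrow> \<zeta> x = 1) \<and> (\<forall>x. infdist x Z \<ge> 4 * \<epsilon> \<longrightarrow> \<zeta> x = 0))"
    using cutoff Z by metis
  obtain M2 where M2: "M2 \<ge> 0" "dbound 4 (\<lambda>j x. M2) \<psi>"
    using Ck_compact_support_dbound[OF \<psi>] by blast
  define c where "c = 1 + 16 * ((1 + 16 * M) * M2)"
  have "\<exists>\<zeta>. Ck_on 4 UNIV (\<lambda>x. (1 - \<zeta> x) * \<psi> x) \<and>
     dbound 4 (\<lambda>j x. c * wt \<epsilon> x ^ j) (\<lambda>x. (1 - \<zeta> x) * \<psi> x) \<and>
     (\<forall>x. 0 \<le> \<zeta> x \<and> \<zeta> x \<le> 1) \<and>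
     (\<forall>x. infdist x Z \<le> \<epsilon> \<longrightarrow> \<zeta> x = 1) \<and> (\<forall>x. infdist x Z \<ge> 4 * \<epsilon> \<longrightarrow> \<zeta> x = 0)"
    if \<epsilon>: "0 < \<epsilon>" "\<epsilon> \<le> 1" for \<epsilon>
  proof -
    obtain \<zeta> where \<zeta>: "Ck_on 4 UNIV \<zeta>" "dbound 4 (\<lambda>j x. if infdist x Z \<le> 4 * \<epsilon> then M * (1 / \<epsilon>) ^ j else 0) \<zeta>"
      "\<And>x. 0 \<le> \<zeta> x \<and> \<zeta> x \<le> 1" "\<And>x. infdist x Z \<le> \<epsilon> \<Longrightarrow> \<zeta> x = 1" "\<And>x. infdist x Z \<ge> 4 * \<epsilon> \<Longrightarrow> \<zeta> x = 0"
      using ex[OF \<epsilon>(1)] by blast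
    have w1: "1 \<le> wt \<epsilon> x ^ j" for j x using wt_ge_1[OF \<epsilon>] by (rule one_le_power)
    have p2: "(2::real) ^ j \<le> 16" if "j \<le> 4" for j
      using power_increasing[OF that, of "2::real"] by simp
    have d\<zeta>: "dbound 4 (\<lambda>j x. M * wt \<epsilon> x ^ j) \<zeta>"
      by (rule dbound_mono[OF \<zeta>(2)]) (use M \<epsilon> in \<open>auto simp: wt_def\<close>)
    have C1: "Ck_on 4 UNIV (\<lambda>x. (- 1) * \<zeta> x)" by (intro Ck_on_mult Ck_on_const \<zeta> open_UNIV)
    have "dbound 4 (\<lambda>j x. 2 ^ j * (M * wt \<epsilon> x ^ j)) (\<lambda>x. (- 1) * \<zeta> x)"
      by (rule dbound_mult[OF Ck_on_const \<zeta>(1) dbound_const d\<zeta>])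
        (use M w1 order_trans[OF zero_le_one w1] in auto)
    from dbound_add[OF Ck_on_const C1 dbound_const this]
    have "dbound 4 (\<lambda>j x. (1 + 16 * M) * wt \<epsilon> x ^ j) (\<lambda>x. 1 + (- 1) * \<zeta> x)"
    proof (rule dbound_mono)
      fix j :: nat and x assume "j \<le> 4"
      have "2 ^ j * (M * wt \<epsilon> x ^ j) \<le> 16 * (M * wt \<epsilon> x ^ j)"
        using M order_trans[OF zero_le_one w1] by (intro mult_right_mono p2 \<open>j \<le> 4\<close>) auto
      then show "(if j = 0 then \<bar>1\<bar> else 0) + 2 ^ j * (M * wt \<epsilon> x ^ j) \<le> (1 + 16 * M) * wt \<epsilon> x ^ j"
        using w1[of x j] by (auto simp: algebra_simps)
    qed
    then have d1: "dbound 4 (\<lambda>j x. (1 + 16 * M) * wt \<epsilon> x ^ j) (\<lambda>x. 1 - \<zeta> x)" by simp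
    have C2: "Ck_on 4 UNIV (\<lambda>x. 1 - \<zeta> x)" using Ck_on_add[OF open_UNIV Ck_on_const C1, of 1] by simp
    have "dbound 4 (\<lambda>j x. 2 ^ j * ((1 + 16 * M) * M2 * wt \<epsilon> x ^ j)) (\<lambda>x. (1 - \<zeta> x) * \<psi> x)"
    proof (rule dbound_mult[OF C2 \<psi>(1) d1 M2(2)])
      fix i j :: nat and x
      have "wt \<epsilon> x ^ i \<le> wt \<epsilon> x ^ (i + j)" using wt_ge_1[OF \<epsilon>] by (intro power_increasing) auto
      then have "(1 + 16 * M) * M2 * wt \<epsilon> x ^ i \<le> (1 + 16 * M) * M2 * wt \<epsilon> x ^ (i + j)"
        using M M2 by (intro mult_left_mono) auto
      then show "(1 + 16 * M) * wt \<epsilon> x ^ i * M2 \<le> (1 + 16 * M) * M2 * wt \<epsilon> x ^ (i + j)"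
        by (simp add: mult_ac)
    qed
    then have "dbound 4 (\<lambda>j x. c * wt \<epsilon> x ^ j) (\<lambda>x. (1 - \<zeta> x) * \<psi> x)"
    proof (rule dbound_mono)
      fix j :: nat and x assume "j \<le> 4"
      have 0: "0 \<le> wt \<epsilon> x ^ j" using order_trans[OF zero_le_one w1] .
      have "2 ^ j * ((1 + 16 * M) * M2 * wt \<epsilon> x ^ j) \<le> 16 * ((1 + 16 * M) * M2 * wt \<epsilon> x ^ j)"
        using M M2 0 by (intro mult_right_mono p2 \<open>j \<le> 4\<close>) auto
      also have "\<dots> \<le> c * wt \<epsilon> x ^ j" using 0 by (simp add: c_def algebra_simps)
      finally show "2 ^ j * ((1 + 16 * M) * M2 * wt \<epsilon> x ^ j) \<le> c * wt \<epsilon> x ^ j" .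
    qed
    moreover have "Ck_on 4 UNIV (\<lambda>x. (1 - \<zeta> x) * \<psi> x)" by (intro Ck_on_mult C2 \<psi> open_UNIV)
    ultimately show ?thesis using \<zeta>(3-5) by blast
  qed
  moreover have "c \<ge> 1" using M M2 by (simp add: c_def)
  ultimately show ?thesis by blast
qed

lemma away_from_Z:
  "compact K \<Longrightarrow> compact (K \<inter> {x. infdist x Z \<ge> \<epsilon>})"
  "\<epsilon> > 0 \<Longrightarrow> K \<inter> {x. infdist x Z \<ge> \<epsilon>} \<subseteq> - Z"
  by (auto intro!: compact_Int_closed closed_Collect_le continuous_intros)

text \<open>The powers of \<open>\<epsilon>\<close> cancel: this is where the critical volume bound is used.\<close>

lemma lint_weight:
  assumes \<epsilon>: "0 < \<epsilon>" "4 * \<epsilon> < r0" and "a \<ge> 0"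
  shows "integrable lborel (\<lambda>x. (a * (1 / \<epsilon>) ^ 4) powr q * indicator {x. infdist x Z \<le> 4 * \<epsilon>} x)"
    "(LINT x|lborel. (a * (1 / \<epsilon>) ^ 4) powr q * indicator {x. infdist x Z \<le> 4 * \<epsilon>} x)
       \<le> a powr q * (C * 4 powr (4 * q))"
proof -
  have f: "{x. infdist x Z \<le> 4 * \<epsilon>} \<in> fmeasurable lborel" using compact_nbhd by (rule fmeasurable_compact)
  then show "integrable lborel (\<lambda>x. (a * (1 / \<epsilon>) ^ 4) powr q * indicator {x. infdist x Z \<le> 4 * \<epsilon>} x)"
    by (intro integrable_mult_right integrable_real_indicator) (auto simp: fmeasurable_def)
  have e: "(a * (1 / \<epsilon>) ^ 4) powr q = a powr q * \<epsilon> powr (- (4 * q))"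
  proof -
    have "(1 / \<epsilon>) ^ 4 = \<epsilon> powr (- 4)"
      using \<epsilon>(1) by (simp add: powr_minus powr_realpow[of \<epsilon> 4, simplified] power_one_over inverse_eq_divide)
    then show ?thesis using \<epsilon>(1) assms(3) by (simp add: powr_mult powr_powr)
  qed
  have "(LINT x|lborel. (a * (1 / \<epsilon>) ^ 4) powr q * indicator {x. infdist x Z \<le> 4 * \<epsilon>} x)
      = (a powr q * \<epsilon> powr (- (4 * q))) * measure lborel {x. infdist x Z \<le> 4 * \<epsilon>}"
    unfolding e using f by simp
  also have "\<dots> \<le> (a powr q * \<epsilon> powr (- (4 * q))) * (C * (4 * \<epsilon>) powr (4 * q))"
    using nbhd[of "4 * \<epsilon>"] \<epsilon> by (intro mult_left_mono) auto
  also have "\<dots> = a powr q * (C * 4 powr (4 * q)) * (\<epsilon> powr (- (4 * q)) * \<epsilon> powr (4 * q))"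
    using \<epsilon>(1) by (simp add: powr_mult)
  also have "\<dots> = a powr q * (C * 4 powr (4 * q))"
    using \<epsilon>(1) by (simp flip: powr_add)
  finally show "(LINT x|lborel. (a * (1 / \<epsilon>) ^ 4) powr q * indicator {x. infdist x Z \<le> 4 * \<epsilon>} x)
       \<le> a powr q * (C * 4 powr (4 * q))" .
qed

end

context punctured_problem begin

section \<open>Local integrability of the nonlinear term\<close>

text \<open>The weak formulation is tested with \<open>\<xi> = h ^ m\<close>, where \<open>h\<close> is a fixed bump function times
a cutoff near \<open>Z\<close>. Its bilaplacian is at most \<open>a * w ^ 4 * h ^ (m - 4)\<close>, and
Young's inequality gives
\<open>v * h ^ (m - 4) * (a * w ^ 4) \<le> (v * h ^ (m - 4)) powr p / p + (a * w ^ 4) powr q / q\<close>.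
For \<open>m \<ge> 4 * q\<close> one has \<open>(m - 4) * p \<ge> m\<close>, so the first term is at most \<open>v powr p * \<xi> / p\<close>; since
\<open>1 / p < 1\<close>, its integral is absorbed by the left-hand side. The integral of the second term is
bounded independently of \<open>\<epsilon>\<close>.\<close>

lemma energy_bound:
  assumes R: "R > 0"
  shows "\<exists>B. \<forall>\<epsilon>. 0 < \<epsilon> \<longrightarrow> \<epsilon> \<le> 1 \<longrightarrow> 4 * \<epsilon> < r0 \<longrightarrow>
     (\<integral>\<^sup>+x. ennreal (v x powr p * indicator (cball 0 R \<inter> {x. infdist x Z \<ge> 4 * \<epsilon>}) x) \<partial>lborel) \<le> ennreal B"
proof -
  obtain m0 :: nat where m0: "real m0 \<ge> 4 * q" using real_arch_simple by blast
  \<comment> \<open>At least \<open>5\<close>, so that a positive power of \<open>h\<close> survives four differentiations.\<close>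
  define m where "m = m0 + 5"
  have m: "real m \<ge> 4 * q" "m \<ge> 5" using m0 by (auto simp: m_def)
  define \<psi> :: "real ^ 'n \<Rightarrow> real" where "\<psi> = (\<lambda>x. bump 5 ((1 / (2 * R)) *\<^sub>R x))"
  have C\<psi>: "Ck_on 4 UNIV \<psi>" unfolding \<psi>_def using Ck_on_bump[of 4] by (intro Ck_on_compose_scale) simp
  have \<psi>0: "\<psi> x = 0" if "x \<notin> cball 0 (2 * R)" for x
    using that R bump_vanish[of 5 "(1 / (2 * R)) *\<^sub>R x"] by (simp add: \<psi>_def field_simps)
  have \<psi>b: "0 \<le> \<psi> x" "\<psi> x \<le> 1" for x by (auto simp: \<psi>_def bump_bounds)
  have \<psi>R: "\<psi> x \<ge> (3/4) ^ 5" if "x \<in> cball 0 R" for x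
    using that R bump_ge[of "(1 / (2 * R)) *\<^sub>R x" 5] by (simp add: \<psi>_def field_simps)
  obtain c where c: "c \<ge> 1" and ex: "\<And>\<epsilon>. 0 < \<epsilon> \<Longrightarrow> \<epsilon> \<le> 1 \<Longrightarrow> (\<exists>\<zeta>. Ck_on 4 UNIV (\<lambda>x. (1 - \<zeta> x) * \<psi> x) \<and>
     dbound 4 (\<lambda>j x. c * wt \<epsilon> x ^ j) (\<lambda>x. (1 - \<zeta> x) * \<psi> x) \<and>
     (\<forall>x. 0 \<le> \<zeta> x \<and> \<zeta> x \<le> 1) \<and>
     (\<forall>x. infdist x Z \<le> \<epsilon> \<longrightarrow> \<zeta> x = 1) \<and> (\<forall>x. infdist x Z \<ge> 4 * \<epsilon> \<longrightarrow> \<zeta> x = 0))"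
    using cutoff_times[OF C\<psi> compact_cball \<psi>0] by blast
  define a where "a = real CARD('n) ^ 2 * (16 * c) ^ m"
  have a: "a \<ge> 0" using c by (simp add: a_def)
  define B where "B = a powr q * (C * 4 powr (4 * q)) + a powr q * measure lborel (cball (0 :: real ^ 'n) (2 * R))"
  have "(\<integral>\<^sup>+x. ennreal (v x powr p * indicator (cball 0 R \<inter> {x. infdist x Z \<ge> 4 * \<epsilon>}) x) \<partial>lborel)
     \<le> ennreal (B / ((3/4) ^ 5) ^ m)" if \<epsilon>: "0 < \<epsilon>" "\<epsilon> \<le> 1" "4 * \<epsilon> < r0" for \<epsilon>
  proof -
    obtain \<zeta> where \<zeta>: "Ck_on 4 UNIV (\<lambda>x. (1 - \<zeta> x) * \<psi> x)"
     "dbound 4 (\<lambda>j x. c * wt \<epsilon> x ^ j) (\<lambda>x. (1 - \<zeta> x) * \<psi> x)" "\<And>x. 0 \<le> \<zeta> x \<and> \<zeta> x \<le> 1"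
     "\<And>x. infdist x Z \<le> \<epsilon> \<Longrightarrow> \<zeta> x = 1" "\<And>x. infdist x Z \<ge> 4 * \<epsilon> \<Longrightarrow> \<zeta> x = 0"
      using ex[OF \<epsilon>(1,2)] by blast
    define h where "h = (\<lambda>x. (1 - \<zeta> x) * \<psi> x)"
    define K where "K = cball 0 (2 * R) \<inter> {x. infdist x Z \<ge> \<epsilon>}"
    have K: "compact K" "K \<subseteq> - Z"
      unfolding K_def using away_from_Z \<epsilon>(1) by auto
    have h0: "h x = 0" if "x \<notin> K" for x
      using that \<psi>0[of x] \<zeta>(4)[of x] by (auto simp: h_def K_def)
    have h: "0 \<le> h x" "h x \<le> 1" for x
      using \<zeta>(3)[of x] \<psi>b[of x] by (auto simp: h_def intro!: mult_le_one)
    have Ch: "Ck_on 4 UNIV h" using \<zeta>(1) by (simp add: h_def)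
    have w1: "1 \<le> wt \<epsilon> x" for x by (rule wt_ge_1[OF \<epsilon>(1,2)])
    have w0: "0 \<le> wt \<epsilon> x" for x using order_trans[OF zero_le_one w1] .
    have "dbound 4 (\<lambda>j x. c * wt \<epsilon> x ^ j) h" using \<zeta>(2) by (simp add: h_def)
    from dbound_replace_0[OF this, of "\<lambda>x. c * h x"]
    have "dbound 4 (\<lambda>j x. if j = 0 then c * h x else c * wt \<epsilon> x ^ j) h"
      using h c mult_right_mono[of 1 c "h _"] by simp
    then have "dbound 4 (\<lambda>j x. c * wt \<epsilon> x ^ j * h x ^ (1 - j)) h"
      by (rule dbound_mono) auto
    note dh = dbound_power[OF Ch h w0 c this]
    define \<xi> where "\<xi> = (\<lambda>x. h x ^ m)"
    have C\<xi>: "Ck_on 4 UNIV \<xi>" unfolding \<xi>_def by (intro Ck_on_power Ch open_UNIV)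
    have \<xi>0: "\<xi> x = 0" if "x \<notin> K" for x using h0[OF that] m by (simp add: \<xi>_def)
    have b\<xi>: "\<bar>bilaplacian \<xi> x\<bar> \<le> a * wt \<epsilon> x ^ 4 * h x ^ (m - 4)" for x
      using dbound_bilaplacian[OF C\<xi>[unfolded \<xi>_def] dh, of x] by (simp add: \<xi>_def a_def mult.assoc)
    note wf = weak_formulation[OF K C\<xi> \<xi>0]
    define Y where "Y = (\<lambda>x. (a * (1 / \<epsilon>) ^ 4) powr q * indicator {x. infdist x Z \<le> 4 * \<epsilon>} x
        + a powr q * indicator (cball 0 (2 * R)) x)"
    have icb: "integrable lborel (\<lambda>x :: real ^ 'n. a powr q * indicator (cball 0 (2 * R)) x)"
      using emeasure_lborel_cball_finite[of "0 :: real ^ 'n" "2 * R"]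
      by (intro integrable_mult_right integrable_real_indicator) auto
    have iY: "integrable lborel Y" unfolding Y_def by (intro Bochner_Integration.integrable_add lint_weight(1) icb \<epsilon> a)
    have "(LINT x|lborel. Y x) = (LINT x|lborel. (a * (1 / \<epsilon>) ^ 4) powr q * indicator {x. infdist x Z \<le> 4 * \<epsilon>} x)
       + (LINT x|lborel. a powr q * indicator (cball (0 :: real ^ 'n) (2 * R)) x)"
      unfolding Y_def by (intro Bochner_Integration.integral_add lint_weight(1) icb \<epsilon> a)
    also have "\<dots> \<le> B" unfolding B_def
      by (intro add_mono lint_weight(2) \<epsilon> a) simp
    finally have YB: "(LINT x|lborel. Y x) \<le> B" .
    have key: "v x * bilaplacian \<xi> x \<le> v x powr p * \<xi> x / p + Y x / q" for x
    proof (cases "x \<in> cball 0 (2 * R)")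
      case False
      then have "x \<notin> K" by (auto simp: K_def)
      then have "bilaplacian \<xi> x = 0" "\<xi> x = 0"
        using bilaplacian_vanish[OF compact_imp_closed[OF K(1)] \<xi>0] \<xi>0 by auto
      then show ?thesis using q by (simp add: Y_def)
    next
      case True
      have pw: "(v x * h x ^ (m - 4)) powr p \<le> v x powr p * \<xi> x"
      proof (cases "h x = 0")
        case True
        then show ?thesis using m v_nonneg by (simp add: \<xi>_def power_0_left)
      next
        case False
        then have hp: "h x > 0" using h(1)[of x] by simp
        have "m * (p - 1) \<ge> 4 * p" using m(1) p by (simp add: q_def field_simps)
        then have "real m \<le> real (m - 4) * p" using m(2) by (simp add: of_nat_diff algebra_simps)
        then have "h x powr (real (m - 4) * p) \<le> h x powr real m"
          using hp h(2)[of x] by (intro powr_mono') auto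
        then have "(h x ^ (m - 4)) powr p \<le> \<xi> x"
          using hp by (simp add: \<xi>_def powr_realpow[symmetric] powr_powr)
        then show ?thesis using v_nonneg[of x] h(1)[of x] by (simp add: powr_mult mult_left_mono)
      qed
      have wY: "(a * wt \<epsilon> x ^ 4) powr q \<le> Y x"
        using True by (auto simp: Y_def wt_def)
      have "v x * bilaplacian \<xi> x \<le> v x * (a * wt \<epsilon> x ^ 4 * h x ^ (m - 4))"
        using b\<xi>[of x] v_nonneg[of x] by (intro mult_left_mono) auto
      also have "\<dots> = (v x * h x ^ (m - 4)) * (a * wt \<epsilon> x ^ 4)" by (simp add: mult_ac)
      also have "\<dots> \<le> (v x * h x ^ (m - 4)) powr p / p + (a * wt \<epsilon> x ^ 4) powr q / q"
        unfolding q_def using v_nonneg[of x] h(1)[of x] a w0[of x] by (intro Youngs_inequality' p) auto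
      also have "\<dots> \<le> v x powr p * \<xi> x / p + Y x / q"
        using pw wY p q by (intro add_mono divide_right_mono) auto
      finally show ?thesis .
    qed
    define X where "X = (LINT x|lborel. v x powr p * \<xi> x)"
    have "X = (LINT x|lborel. v x * bilaplacian \<xi> x)" unfolding X_def by (rule wf(3))
    also have "\<dots> \<le> (LINT x|lborel. v x powr p * \<xi> x / p + Y x / q)"
      by (intro integral_mono wf key Bochner_Integration.integrable_add integrable_divide iY)
    also have "\<dots> = X / p + (LINT x|lborel. Y x) / q"
      using wf(1) iY by (simp add: X_def)
    finally have "X * (1 - 1 / p) \<le> (LINT x|lborel. Y x) * (1 / q)" by (simp add: algebra_simps)
    moreover have "1 - 1 / p = 1 / q" using p by (simp add: q_def field_simps)
    ultimately have "X * (1 / q) \<le> (LINT x|lborel. Y x) * (1 / q)" by simp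
    then have "X \<le> (LINT x|lborel. Y x)" using q by (simp add: field_simps)
    with YB have XB: "X \<le> B" by simp
    have "(\<integral>\<^sup>+x. ennreal (v x powr p * indicator (cball 0 R \<inter> {x. infdist x Z \<ge> 4 * \<epsilon>}) x) \<partial>lborel)
      \<le> (\<integral>\<^sup>+x. ennreal (v x powr p * \<xi> x / ((3/4) ^ 5) ^ m) \<partial>lborel)"
    proof (intro nn_integral_mono ennreal_leI)
      fix x
      show "v x powr p * indicator (cball 0 R \<inter> {x. infdist x Z \<ge> 4 * \<epsilon>}) x \<le> v x powr p * \<xi> x / ((3/4) ^ 5) ^ m"
      proof (cases "x \<in> cball 0 R \<inter> {x. infdist x Z \<ge> 4 * \<epsilon>}")
        case True
        then have "\<zeta> x = 0" using \<zeta>(5) by simp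
        then have "((3/4) ^ 5) ^ m \<le> \<xi> x"
          unfolding \<xi>_def h_def using \<psi>R[of x] True by (intro power_mono) auto
        then have "v x powr p * ((3/4) ^ 5) ^ m \<le> v x powr p * \<xi> x" by (intro mult_left_mono) auto
        then have "v x powr p \<le> v x powr p * \<xi> x / ((3/4) ^ 5) ^ m" by (subst pos_le_divide_eq) auto
        then show ?thesis using True by simp
      next
        case False
        then show ?thesis using h(1)[of x] by (simp add: \<xi>_def)
      qed
    qed
    also have "\<dots> = ennreal (LINT x|lborel. v x powr p * \<xi> x / ((3/4) ^ 5) ^ m)"
      using wf(1) h by (intro nn_integral_eq_integral) (auto simp: \<xi>_def)
    also have "\<dots> = ennreal (X / ((3/4) ^ 5) ^ m)" using wf(1) by (simp add: X_def)
    also have "\<dots> \<le> ennreal (B / ((3/4) ^ 5) ^ m)" by (intro ennreal_leI divide_right_mono XB) auto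
    finally show ?thesis .
  qed
  then show ?thesis by blast
qed

text \<open>Fatou's lemma along a sequence of scales tending to zero. The limit function has the value \<open>0\<close> on
\<open>Z\<close> by the choice of \<open>v\<close>, so that convergence holds at every point.\<close>

lemma integrable_vp:
  assumes "R > 0"
  shows "integrable lborel (\<lambda>x. v x powr p * indicator (cball 0 R) x)"
proof -
  obtain B where B: "\<And>\<epsilon>. 0 < \<epsilon> \<Longrightarrow> \<epsilon> \<le> 1 \<Longrightarrow> 4 * \<epsilon> < r0 \<Longrightarrow>
     (\<integral>\<^sup>+x. ennreal (v x powr p * indicator (cball 0 R \<inter> {x. infdist x Z \<ge> 4 * \<epsilon>}) x) \<partial>lborel) \<le> ennreal B"
    using energy_bound[OF assms] by blast
  define e where "e = (\<lambda>n. min 1 (r0 / 8) * inverse (real (Suc n)))"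
  have e: "0 < e n" "e n \<le> 1" "4 * e n < r0" for n
  proof -
    have i: "0 < inverse (real (Suc n))" "inverse (real (Suc n)) \<le> 1" by (auto simp: field_simps)
    show "0 < e n" using r0 i by (simp add: e_def)
    have "e n \<le> min 1 (r0 / 8)" unfolding e_def using i r0 by (intro mult_left_le) auto
    then show "e n \<le> 1" "4 * e n < r0" using r0 by (auto simp: min_def split: if_splits)
  qed
  have e0: "e \<longlonglongrightarrow> 0" unfolding e_def
    using tendsto_mult[OF tendsto_const LIMSEQ_inverse_real_of_nat] by simp
  define f where "f = (\<lambda>n x. ennreal (v x powr p * indicator (cball 0 R \<inter> {x. infdist x Z \<ge> 4 * e n}) x))"
  have clm: "{x. infdist x Z \<ge> r} \<in> sets borel" for r
    by (intro borel_closed closed_Collect_le continuous_intros)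
  have "(\<lambda>x. v x powr p * indicator (cball 0 R \<inter> {x. infdist x Z \<ge> 4 * e n}) x) \<in> borel_measurable borel" for n
    using clm[of "4 * e n"] by (intro borel_measurable_times borel_measurable_indicator) auto
  then have fm: "f n \<in> borel_measurable lborel" for n unfolding f_def by simp
  have lim: "liminf (\<lambda>n. f n x) = ennreal (v x powr p * indicator (cball 0 R) x)" for x
  proof -
    have "(\<lambda>n. f n x) \<longlonglongrightarrow> ennreal (v x powr p * indicator (cball 0 R) x)"
    proof (cases "x \<in> Z")
      case True
      then show ?thesis by (simp add: f_def v_def)
    next
      case False
      have "\<forall>\<^sub>F n in sequentially. e n < infdist x Z / 4"
        using infdist_pos[OF False] by (intro order_tendstoD[OF e0]) auto
      then have "\<forall>\<^sub>F n in sequentially. f n x = ennreal (v x powr p * indicator (cball 0 R) x)"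
        by eventually_elim (auto simp: f_def indicator_def)
      then show ?thesis by (rule tendsto_eventually)
    qed
    then show ?thesis by (intro lim_imp_Liminf) auto
  qed
  have "(\<integral>\<^sup>+x. ennreal (v x powr p * indicator (cball 0 R) x) \<partial>lborel) \<le> liminf (\<lambda>n. \<integral>\<^sup>+x. f n x \<partial>lborel)"
    unfolding lim[symmetric] by (rule nn_integral_liminf[OF fm])
  also have "\<dots> \<le> ennreal B"
    by (rule Liminf_le) (use B[OF e] in \<open>auto simp: f_def\<close>)
  finally have "(\<integral>\<^sup>+x. ennreal (v x powr p * indicator (cball 0 R) x) \<partial>lborel) < \<infinity>"
    by (simp add: order_le_less_trans)
  then show ?thesis by (intro integrableI_nonneg) (auto intro!: borel_measurable_times borel_measurable_indicator)
qed

lemma integrable_mult_bounded: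
  assumes g: "g \<in> borel_measurable borel" and b: "\<And>x. \<bar>g x\<bar> \<le> M" and K: "compact K" "\<And>x. x \<notin> K \<Longrightarrow> g x = 0"
  shows "integrable lborel (\<lambda>x. v x powr p * g x)" "integrable lborel (\<lambda>x. v x * g x)"
proof -
  obtain R where R: "R > 0" "K \<subseteq> cball 0 R"
    using compact_imp_bounded[OF K(1)] by (auto simp: bounded_pos subset_iff)
  have M: "M \<ge> 0" using b[of 0] by linarith
  have i1: "integrable lborel (\<lambda>x. v x powr p * indicator (cball 0 R) x)" by (rule integrable_vp[OF R(1)])
  have i2: "integrable lborel (\<lambda>x :: real ^ 'n. indicator (cball 0 R) x :: real)"
    using emeasure_lborel_cball_finite[of "0 :: real ^ 'n" R] by (intro integrable_real_indicator) simp_all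
  have le: "v x \<le> 1 + v x powr p" for x
  proof (cases "v x \<le> 1")
    case True then show ?thesis using powr_ge_zero[of "v x" p] by linarith
  next
    case False
    then have "v x powr 1 \<le> v x powr p" using p by (intro powr_mono) auto
    then show ?thesis using False by simp
  qed
  show "integrable lborel (\<lambda>x. v x powr p * g x)"
  proof (rule Bochner_Integration.integrable_bound[OF integrable_mult_right[OF i1, of M]])
    show "AE x in lborel. norm (v x powr p * g x) \<le> norm (M * (v x powr p * indicator (cball 0 R) x))"
    proof (rule AE_I2)
      fix x
      show "norm (v x powr p * g x) \<le> norm (M * (v x powr p * indicator (cball 0 R) x))"
      proof (cases "x \<in> K")
        case True
        have "v x powr p * \<bar>g x\<bar> \<le> v x powr p * M" by (intro mult_left_mono b) auto
        then show ?thesis using True R(2) M by (auto simp: abs_mult mult.commute indicator_def)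
      qed (simp add: K)
    qed
  qed (use g in measurable)
  show "integrable lborel (\<lambda>x. v x * g x)"
  proof (rule Bochner_Integration.integrable_bound[OF integrable_mult_right[OF Bochner_Integration.integrable_add[OF i2 i1], of M]])
    show "AE x in lborel. norm (v x * g x) \<le> norm (M * (indicator (cball 0 R) x + v x powr p * indicator (cball 0 R) x))"
    proof (rule AE_I2)
      fix x
      show "norm (v x * g x) \<le> norm (M * (indicator (cball 0 R) x + v x powr p * indicator (cball 0 R) x))"
      proof (cases "x \<in> K")
        case True
        have "v x * \<bar>g x\<bar> \<le> (1 + v x powr p) * M" using v_nonneg by (intro mult_mono b le) auto
        then show ?thesis using True R(2) M v_nonneg[of x] by (auto simp: abs_mult mult.commute indicator_def)
      qed (simp add: K)
    qed
  qed (use g in measurable)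
qed

section \<open>The equation across the singular set\<close>

text \<open>The weak formulation holds for \<open>(1 - \<zeta>) * \<phi>\<close>, with a cutoff \<open>\<zeta>\<close> at scale \<open>\<epsilon>\<close>. Passing to \<open>\<phi>\<close>
costs an error carried by the neighbourhood \<open>N \<epsilon>\<close> of \<open>Z\<close>, where the bilaplacians differ by at most
\<open>a * (1 / \<epsilon>) ^ 4\<close>. In place of Hoelder's inequality, Young's inequality with a parameter \<open>\<delta>\<close> splits
\<open>v * a * (1 / \<epsilon>) ^ 4\<close> into \<open>v powr p\<close> with a large constant, whose integral over \<open>N \<epsilon>\<close> tends to \<open>0\<close>
with \<open>\<epsilon>\<close> because \<open>v powr p\<close> is now known to be integrable, and a term whose integral is at most a
constant times \<open>\<delta> powr q\<close>. First \<open>\<epsilon>\<close> and then \<open>\<delta>\<close> tend to zero.\<close>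

lemma weak_solution:
  assumes \<phi>: "Ck_on 4 UNIV \<phi>" "compact K" "\<And>x. x \<notin> K \<Longrightarrow> \<phi> x = 0"
  shows "integrable lborel (\<lambda>x. v x powr p * \<phi> x)" "integrable lborel (\<lambda>x. v x * bilaplacian \<phi> x)"
    "(LINT x|lborel. v x powr p * \<phi> x) = (LINT x|lborel. v x * bilaplacian \<phi> x)"
proof -
  obtain M3 where M3: "M3 \<ge> 0" "dbound 4 (\<lambda>j x. M3) \<phi>"
    using Ck_compact_support_dbound[OF \<phi>] by blast
  define n2 where "n2 = real CARD('n) ^ 2"
  have b\<phi>: "\<bar>\<phi> x\<bar> \<le> M3" "\<bar>bilaplacian \<phi> x\<bar> \<le> n2 * M3" for x
    using dbound_0[OF M3(2), of x] dbound_bilaplacian[OF \<phi>(1) M3(2), of x] by (auto simp: n2_def)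
  have bz: "bilaplacian \<phi> x = 0" if "x \<notin> K" for x
    by (rule bilaplacian_vanish[OF compact_imp_closed[OF \<phi>(2)] \<phi>(3) that])
  have 4: "(4::nat) = Suc (Suc (Suc (Suc 0)))" by simp
  have "Ck_on 0 UNIV (bilaplacian \<phi>)"
    unfolding bilaplacian_def using \<phi>(1) unfolding 4 by (intro Ck_on_laplacian open_UNIV)
  then have m: "bilaplacian \<phi> \<in> borel_measurable borel" "\<phi> \<in> borel_measurable borel"
    using Ck_on_continuous[OF \<phi>(1)] by (auto intro: borel_measurable_continuous_onI)
  show i1: "integrable lborel (\<lambda>x. v x powr p * \<phi> x)"
    by (rule integrable_mult_bounded(1)[OF m(2) b\<phi>(1) \<phi>(2,3)])
  show i2: "integrable lborel (\<lambda>x. v x * bilaplacian \<phi> x)"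
    by (rule integrable_mult_bounded(2)[OF m(1) b\<phi>(2) \<phi>(2) bz])
  obtain c where c: "c \<ge> 1" and ex: "\<And>\<epsilon>. 0 < \<epsilon> \<Longrightarrow> \<epsilon> \<le> 1 \<Longrightarrow> (\<exists>\<zeta>. Ck_on 4 UNIV (\<lambda>x. (1 - \<zeta> x) * \<phi> x) \<and>
     dbound 4 (\<lambda>j x. c * wt \<epsilon> x ^ j) (\<lambda>x. (1 - \<zeta> x) * \<phi> x) \<and>
     (\<forall>x. 0 \<le> \<zeta> x \<and> \<zeta> x \<le> 1) \<and>
     (\<forall>x. infdist x Z \<le> \<epsilon> \<longrightarrow> \<zeta> x = 1) \<and> (\<forall>x. infdist x Z \<ge> 4 * \<epsilon> \<longrightarrow> \<zeta> x = 0))"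
    using cutoff_times[OF \<phi>] by blast
  define a where "a = n2 * M3 + n2 * c"
  have n2: "n2 \<ge> 0" by (simp add: n2_def)
  have a: "a \<ge> 0" using n2 M3 c by (simp add: a_def)
  define E where "E = \<bar>(LINT x|lborel. v x * bilaplacian \<phi> x) - (LINT x|lborel. v x powr p * \<phi> x)\<bar>"
  define N where "N = (\<lambda>\<epsilon>. {x. infdist x Z \<le> 4 * \<epsilon>})"
  have mN: "N \<epsilon> \<in> sets borel" for \<epsilon> unfolding N_def using closed_nbhd by (rule borel_closed)
  define I where "I = (\<lambda>\<epsilon>. LINT x|lborel. v x powr p * indicator (N \<epsilon>) x)"
  have iN: "integrable lborel (\<lambda>x. v x powr p * indicator (N \<epsilon>) x)" for \<epsilon>
    by (rule integrable_mult_bounded(1)[where M=1 and K="N \<epsilon>"])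
      (use compact_nbhd[of "4 * \<epsilon>"] mN[of \<epsilon>] in \<open>auto simp: N_def\<close>)
  have main: "E \<le> (\<delta> powr (- p) + M3) * I \<epsilon> + \<delta> powr q * (a powr q * (C * 4 powr (4 * q)))"
    if \<epsilon>: "0 < \<epsilon>" "\<epsilon> \<le> 1" "4 * \<epsilon> < r0" and \<delta>: "\<delta> > 0" for \<epsilon> \<delta>
  proof -
    obtain \<zeta> where \<zeta>: "Ck_on 4 UNIV (\<lambda>x. (1 - \<zeta> x) * \<phi> x)"
     "dbound 4 (\<lambda>j x. c * wt \<epsilon> x ^ j) (\<lambda>x. (1 - \<zeta> x) * \<phi> x)" "\<And>x. 0 \<le> \<zeta> x \<and> \<zeta> x \<le> 1"
     "\<And>x. infdist x Z \<le> \<epsilon> \<Longrightarrow> \<zeta> x = 1" "\<And>x. infdist x Z \<ge> 4 * \<epsilon> \<Longrightarrow> \<zeta> x = 0"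
      using ex[OF \<epsilon>(1,2)] by blast
    define \<xi> where "\<xi> = (\<lambda>x. (1 - \<zeta> x) * \<phi> x)"
    define K' where "K' = K \<inter> {x. infdist x Z \<ge> \<epsilon>}"
    have K': "compact K'" "K' \<subseteq> - Z"
      unfolding K'_def using away_from_Z \<epsilon>(1) \<phi>(2) by auto
    have \<xi>0: "\<xi> x = 0" if "x \<notin> K'" for x
      using that \<phi>(3)[of x] \<zeta>(4)[of x] by (auto simp: \<xi>_def K'_def)
    have C\<xi>: "Ck_on 4 UNIV \<xi>" using \<zeta>(1) by (simp add: \<xi>_def)
    note wf = weak_formulation[OF K' C\<xi> \<xi>0]
    have b\<xi>: "\<bar>bilaplacian \<xi> x\<bar> \<le> n2 * (c * wt \<epsilon> x ^ 4)" for x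
      using dbound_bilaplacian[OF \<zeta>(1,2), of x] by (simp add: \<xi>_def n2_def)
    define W where "W = (\<lambda>x. (\<delta> * a * (1 / \<epsilon>) ^ 4) powr q * indicator {x. infdist x Z \<le> 4 * \<epsilon>} x)"
    have iW: "integrable lborel W" and W: "(LINT x|lborel. W x) \<le> \<delta> powr q * (a powr q * (C * 4 powr (4 * q)))"
      using lint_weight[OF \<epsilon>(1,3), of "\<delta> * a"] a \<delta> by (auto simp: W_def powr_mult mult.assoc)
    define d where "d = (\<lambda>x. (v x * bilaplacian \<phi> x - v x * bilaplacian \<xi> x) - (v x powr p * \<phi> x - v x powr p * \<xi> x))"
    have id: "integrable lborel d" unfolding d_def by (intro Bochner_Integration.integrable_diff i1 i2 wf)
    have "(LINT x|lborel. d x) = (LINT x|lborel. v x * bilaplacian \<phi> x) - (LINT x|lborel. v x powr p * \<phi> x)"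
      unfolding d_def using i1 i2 wf by simp
    then have "E = \<bar>LINT x|lborel. d x\<bar>" by (simp add: E_def)
    also have "\<dots> \<le> (LINT x|lborel. \<bar>d x\<bar>)" by (rule integral_abs_bound)
    also have "\<dots> \<le> (LINT x|lborel. (\<delta> powr (- p) + M3) * (v x powr p * indicator (N \<epsilon>) x) + W x)"
    proof (rule integral_mono)
      fix x
      show "\<bar>d x\<bar> \<le> (\<delta> powr (- p) + M3) * (v x powr p * indicator (N \<epsilon>) x) + W x"
      proof (cases "x \<in> N \<epsilon>")
        case False
        have "open (- N \<epsilon>)" unfolding N_def using closed_nbhd by (rule open_Compl)
        moreover have "\<xi> y = \<phi> y" if "y \<in> - N \<epsilon>" for y using that \<zeta>(5)[of y] by (simp add: \<xi>_def N_def)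
        ultimately have "bilaplacian \<xi> x = bilaplacian \<phi> x" "\<xi> x = \<phi> x"
          using bilaplacian_cong_open[of "- N \<epsilon>" x \<xi> \<phi>] False by auto
        then show ?thesis using False by (simp add: d_def W_def N_def)
      next
        case True
        have wx: "wt \<epsilon> x = 1 / \<epsilon>" using True by (simp add: wt_def N_def)
        have e1: "1 \<le> (1 / \<epsilon>) ^ 4" using \<epsilon> by (intro one_le_power) auto
        have "\<bar>bilaplacian \<phi> x - bilaplacian \<xi> x\<bar> \<le> n2 * M3 * 1 + n2 * (c * (1 / \<epsilon>) ^ 4)"
          using b\<phi>(2)[of x] b\<xi>[of x] unfolding wx by linarith
        also have "\<dots> \<le> n2 * M3 * (1 / \<epsilon>) ^ 4 + n2 * (c * (1 / \<epsilon>) ^ 4)"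
          using n2 M3(1) by (intro add_right_mono mult_left_mono e1) auto
        also have "\<dots> = a * (1 / \<epsilon>) ^ 4" by (simp add: a_def algebra_simps)
        finally have "v x * \<bar>bilaplacian \<phi> x - bilaplacian \<xi> x\<bar> \<le> v x * (a * (1 / \<epsilon>) ^ 4)"
          by (intro mult_left_mono v_nonneg)
        also have "\<dots> = (v x / \<delta>) * (\<delta> * a * (1 / \<epsilon>) ^ 4)" using \<delta> by simp
        also have "\<dots> \<le> (v x / \<delta>) powr p / p + (\<delta> * a * (1 / \<epsilon>) ^ 4) powr q / q"
          unfolding q_def using v_nonneg[of x] \<delta> a \<epsilon> by (intro Youngs_inequality' p) auto
        also have "\<dots> \<le> (v x / \<delta>) powr p + (\<delta> * a * (1 / \<epsilon>) ^ 4) powr q"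
          using p q by (intro add_mono) (auto simp: divide_le_eq mult_left_mono[of 1 _ "_ powr _", simplified])
        also have "(v x / \<delta>) powr p = \<delta> powr (- p) * v x powr p"
          using v_nonneg[of x] \<delta> by (simp add: powr_divide powr_minus field_simps)
        finally have 1: "v x * \<bar>bilaplacian \<phi> x - bilaplacian \<xi> x\<bar> \<le> \<delta> powr (- p) * v x powr p + W x"
          using True by (simp add: W_def N_def)
        have "\<phi> x - \<xi> x = \<zeta> x * \<phi> x" by (simp add: \<xi>_def algebra_simps)
        moreover have "\<bar>\<zeta> x * \<phi> x\<bar> \<le> 1 * M3"
          unfolding abs_mult using \<zeta>(3)[of x] b\<phi>(1)[of x] by (intro mult_mono) auto
        ultimately have "\<bar>\<phi> x - \<xi> x\<bar> \<le> M3" by simp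
        then have 2: "v x powr p * \<bar>\<phi> x - \<xi> x\<bar> \<le> v x powr p * M3" by (intro mult_left_mono) auto
        have "\<bar>d x\<bar> \<le> \<bar>v x * (bilaplacian \<phi> x - bilaplacian \<xi> x)\<bar> + \<bar>v x powr p * (\<phi> x - \<xi> x)\<bar>"
          unfolding d_def by (simp add: right_diff_distrib)
        also have "\<dots> \<le> (\<delta> powr (- p) * v x powr p + W x) + v x powr p * M3"
          using 1 2 v_nonneg[of x] by (simp add: abs_mult)
        finally show ?thesis using True by (simp add: algebra_simps)
      qed
    qed (intro integrable_abs id Bochner_Integration.integrable_add integrable_mult_right iN iW)+
    also have "\<dots> = (\<delta> powr (- p) + M3) * I \<epsilon> + (LINT x|lborel. W x)"
      unfolding I_def using iN[of \<epsilon>] iW by simp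
    finally show ?thesis using W by linarith
  qed
  have I0: "(I \<longlongrightarrow> 0) (at_right 0)"
  proof -
    have "((\<lambda>\<epsilon>. LINT x|lborel. v x powr p * indicator (N \<epsilon>) x) \<longlongrightarrow> (LINT x|(lborel :: (real ^ 'n) measure). (0::real))) (at_right (0::real))"
    proof (rule tendsto_at_right_sequentially[where b=1])
      fix S :: "nat \<Rightarrow> real" assume S: "\<And>n. 0 < S n" "\<And>n. S n < 1" "decseq S" "S \<longlonglongrightarrow> 0"
      show "(\<lambda>n. LINT x|lborel. v x powr p * indicator (N (S n)) x) \<longlonglongrightarrow> (LINT x|(lborel :: (real ^ 'n) measure). (0::real))"
      proof (rule integral_dominated_convergence[where w="\<lambda>x. v x powr p * indicator (N 1) x"])
        show "integrable lborel (\<lambda>x. v x powr p * indicator (N 1) x)" by (rule iN)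
        show "(\<lambda>x. v x powr p * indicator (N (S n)) x) \<in> borel_measurable lborel" for n
          using iN by (rule borel_measurable_integrable)
        show "AE x in lborel. (\<lambda>n. v x powr p * indicator (N (S n)) x) \<longlonglongrightarrow> 0"
        proof (rule AE_I2)
          fix x
          show "(\<lambda>n. v x powr p * indicator (N (S n)) x) \<longlonglongrightarrow> 0"
          proof (cases "x \<in> Z")
            case True then show ?thesis by (simp add: v_def)
          next
            case False
            have "\<forall>\<^sub>F n in sequentially. S n < infdist x Z / 4"
              using infdist_pos[OF False] by (intro order_tendstoD[OF S(4)]) auto
            then have "\<forall>\<^sub>F n in sequentially. v x powr p * indicator (N (S n)) x = 0"
              by eventually_elim (auto simp: N_def)
            then show ?thesis by (rule tendsto_eventually)
          qed
        qed
        show "AE x in lborel. norm (v x powr p * indicator (N (S n)) x) \<le> v x powr p * indicator (N 1) x" for n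
          using S(2)[of n] by (intro AE_I2) (auto simp: N_def indicator_def)
      qed auto
    qed auto
    then show ?thesis by (simp add: I_def)
  qed
  have E\<delta>: "E \<le> \<delta> powr q * (a powr q * (C * 4 powr (4 * q)))" if "\<delta> > 0" for \<delta>
  proof (rule tendsto_lowerbound[where F="at_right (0::real)"])
    show "((\<lambda>\<epsilon>. (\<delta> powr (- p) + M3) * I \<epsilon> + \<delta> powr q * (a powr q * (C * 4 powr (4 * q))))
        \<longlongrightarrow> \<delta> powr q * (a powr q * (C * 4 powr (4 * q)))) (at_right 0)"
      using tendsto_add[OF tendsto_mult[OF tendsto_const I0] tendsto_const] by simp
    have "\<forall>\<^sub>F \<epsilon> in at_right (0::real). 0 < \<epsilon> \<and> \<epsilon> < min 1 (r0 / 4)"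
      using r0 by (intro eventually_conj eventually_at_right_less eventually_at_rightI[where b="min 1 (r0 / 4)"]) auto
    then show "\<forall>\<^sub>F \<epsilon> in at_right (0::real). E \<le> (\<delta> powr (- p) + M3) * I \<epsilon> + \<delta> powr q * (a powr q * (C * 4 powr (4 * q)))"
      by eventually_elim (rule main, use that in auto)
  qed auto
  have "E \<le> 0"
  proof (rule tendsto_lowerbound[where F="at_right (0::real)"])
    have "((\<lambda>\<delta>. \<delta> powr q) \<longlongrightarrow> 0) (at_right (0::real))"
      using q by (intro tendsto_zero_powrI)
        (auto intro!: tendsto_eq_intros eventually_mono[OF eventually_at_right_less[of 0]])
    then show "((\<lambda>\<delta>. \<delta> powr q * (a powr q * (C * 4 powr (4 * q)))) \<longlongrightarrow> 0) (at_right 0)"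
      by (rule tendsto_mult_left_zero)
    show "\<forall>\<^sub>F \<delta> in at_right (0::real). E \<le> \<delta> powr q * (a powr q * (C * 4 powr (4 * q)))"
      using eventually_at_right_less[of 0] by eventually_elim (rule E\<delta>)
  qed auto
  then show "(LINT x|lborel. v x powr p * \<phi> x) = (LINT x|lborel. v x * bilaplacian \<phi> x)"
    by (simp add: E_def)
qed

lemma u_eq_v_AE: "AE x in lebesgue. u x = v x"
proof -
  have "Z \<in> null_sets lebesgue" using null_Z by (rule null_sets_completionI)
  then show ?thesis by (rule AE_I') (auto simp: v_def)
qed

lemma lebesgue_u:
  assumes "\<And>x. u x = v x \<Longrightarrow> F x = G x" "integrable lborel G"
  shows "integrable lebesgue F" "(LINT x|lebesgue. F x) = (LINT x|lborel. G x :: real)"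
proof -
  have G: "integrable lebesgue G" "(LINT x|lebesgue. G x) = (LINT x|lborel. G x)"
    using assms(2) by (auto simp: integrable_completion integral_completion)
  have ae: "AE x in lebesgue. G x = F x" using u_eq_v_AE by eventually_elim (simp add: assms(1))
  have "F \<in> borel_measurable lebesgue"
    using borel_measurable_integrable[OF G(1)] ae by (rule borel_measurable_AE)
  then show "integrable lebesgue F" "(LINT x|lebesgue. F x) = (LINT x|lborel. G x)"
    using integrable_cong_AE[of F lebesgue G] integral_cong_AE[of F lebesgue G] G ae
      borel_measurable_integrable[OF G(1)] by (auto simp: eq_commute)
qed

theorem removable_singularity: "Lp_loc p u \<and> distributional_solution p u"
proof
  have "set_integrable lebesgue K (\<lambda>x. \<bar>u x\<bar> powr p)" if "compact K" for K
  proof -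
    have "integrable lborel (\<lambda>x. v x powr p * indicator K x)"
      using that by (intro integrable_mult_bounded(1)[where M=1 and K=K])
        (auto intro!: borel_measurable_indicator borel_closed compact_imp_closed)
    then show ?thesis unfolding set_integrable_def
      by (rule lebesgue_u(1)[rotated]) (use v_nonneg in \<open>auto simp: mult.commute\<close>)
  qed
  moreover have "u \<in> borel_measurable lebesgue"
  proof (rule borel_measurable_AE)
    show "v \<in> borel_measurable lebesgue" by (rule measurable_completion) simp
    show "AE x in lebesgue. v x = u x" using u_eq_v_AE by eventually_elim simp
  qed
  ultimately show "Lp_loc p u" by (simp add: Lp_loc_def)
  show "distributional_solution p u" unfolding distributional_solution_def
  proof (intro allI impI)
    fix \<phi> :: "real ^ 'n \<Rightarrow> real" assume t: "test_function \<phi>"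
    then have \<phi>: "Ck_on 4 UNIV \<phi>" "compact (closure {x. \<phi> x \<noteq> 0})"
      by (auto simp: test_function_def Cinfty_on_def simp del: Ck_on.simps)
    have "\<phi> x = 0" if "x \<notin> closure {x. \<phi> x \<noteq> 0}" for x
      using that closure_subset[of "{x. \<phi> x \<noteq> 0}"] by auto
    note ws = weak_solution[OF \<phi> this]
    show "integrable lebesgue (\<lambda>x. u x * bilaplacian \<phi> x) \<and> integrable lebesgue (\<lambda>x. u x powr p * \<phi> x) \<and>
        (LINT x|lebesgue. u x * bilaplacian \<phi> x) = (LINT x|lebesgue. u x powr p * \<phi> x)"
      using lebesgue_u[of "\<lambda>x. u x * bilaplacian \<phi> x" "\<lambda>x. v x * bilaplacian \<phi> x"]
        lebesgue_u[of "\<lambda>x. u x powr p * \<phi> x" "\<lambda>x. v x powr p * \<phi> x"] ws by simp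
  qed
qed

end

section \<open>The volume of neighbourhoods\<close>

lemma measure_nbhd_le_cover:
  fixes Z :: "'a::euclidean_space set"
  assumes Z: "compact Z" "Z \<noteq> {}" and A: "finite A" "Z \<subseteq> (\<Union>a\<in>A. cball a s)" and "s \<ge> 0" "r \<ge> 0"
  shows "measure lborel {x. infdist x Z \<le> r} \<le> real (card A) * (unit_ball_vol (real DIM('a)) * (s + r) ^ DIM('a))"
proof -
  have sub: "{x. infdist x Z \<le> r} \<subseteq> (\<Union>a\<in>A. cball a (s + r))"
  proof
    fix x assume x: "x \<in> {x. infdist x Z \<le> r}"
    obtain z where z: "z \<in> Z" "infdist x Z = dist x z"
      using infdist_attains_inf[OF compact_imp_closed[OF Z(1)] Z(2)] by blast
    then obtain a where a: "a \<in> A" "dist a z \<le> s" using A(2) by force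
    have "dist a x \<le> s + r" using a(2) z(2) x dist_triangle[of a x z] by (simp add: dist_commute)
    then show "x \<in> (\<Union>a\<in>A. cball a (s + r))" using a(1) by auto
  qed
  have fm: "cball a (s + r) \<in> fmeasurable lborel" for a :: 'a by (rule fmeasurable_compact) simp
  have "closed {x. infdist x Z \<le> r}" by (intro closed_Collect_le continuous_intros)
  then have "measure lborel {x. infdist x Z \<le> r} \<le> measure lborel (\<Union>a\<in>A. cball a (s + r))"
    by (intro measure_mono_fmeasurable sub fmeasurable.finite_UN A fm) auto
  also have "\<dots> \<le> (\<Sum>a\<in>A. measure lborel (cball a (s + r)))"
    by (intro measure_UNION_le A) auto
  also have "\<dots> = real (card A) * (unit_ball_vol (real DIM('a)) * (s + r) ^ DIM('a))"
    using assms(5,6) by (simp add: content_cball)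
  finally show ?thesis .
qed

text \<open>If \<open>l\<close> balls of radius \<open>r\<close> cover \<open>Z\<close>, then balls of twice the radius cover its \<open>r\<close>-neighbourhood. A
dimension below \<open>N - t\<close>, where \<open>N\<close> is the dimension of the space, provides an exponent \<open>d < N - t\<close>
with \<open>l * r powr d < 1\<close> for small \<open>r\<close>, so the volume is of order \<open>r powr (N - d)\<close>.\<close>

lemma minkowski_nbhd_bound:
  fixes Z :: "(real ^ 'n::finite) set"
  assumes Z: "compact Z" "Z \<noteq> {}" and dim: "upper_minkowski_dim Z < ereal (real CARD('n) - t)"
  shows "\<exists>C r0. r0 > 0 \<and> (\<forall>r. 0 < r \<longrightarrow> r < r0 \<longrightarrow> measure lborel {x. infdist x Z \<le> r} \<le> C * r powr t)"
proof -
  obtain d where d: "0 \<le> d" "Limsup (at_right 0) (\<lambda>r. minkowski_content d r Z) = 0" "d < real CARD('n) - t"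
    using dim unfolding upper_minkowski_dim_def Inf_less_iff by auto
  have "\<forall>\<^sub>F r in at_right 0. minkowski_content d r Z < 1"
    by (rule Limsup_lessD) (simp add: d(2))
  then obtain b where b: "b > 0" "\<And>r. 0 < r \<Longrightarrow> r < b \<Longrightarrow> minkowski_content d r Z < 1"
    unfolding eventually_at_right_field by auto
  define V where "V = unit_ball_vol (real CARD('n)) * 2 ^ CARD('n)"
  have V: "V \<ge> 0" by (simp add: V_def)
  have "measure lborel {x. infdist x Z \<le> r} \<le> V * r powr t" if r: "0 < r" "r < min b 1" for r
  proof -
    have "minkowski_content d r Z < 1" using b(2) r by simp
    then obtain l :: nat and x :: "nat \<Rightarrow> real ^ 'n" where lx: "real l * r powr d < 1" "Z \<subseteq> (\<Union>k\<in>{1..l}. ball (x k) r)"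
      unfolding minkowski_content_def Inf_less_iff by auto
    have "Z \<subseteq> (\<Union>a\<in>x ` {1..l}. cball a r)"
      using lx(2) by (auto simp: subset_eq) (meson atLeastAtMost_iff less_imp_le)
    from measure_nbhd_le_cover[OF Z _ this, of r] r
    have "measure lborel {x. infdist x Z \<le> r} \<le> real (card (x ` {1..l})) * (unit_ball_vol (real CARD('n)) * (r + r) ^ CARD('n))"
      by simp
    also have "\<dots> \<le> real l * (unit_ball_vol (real CARD('n)) * (r + r) ^ CARD('n))"
      using card_image_le[of "{1..l}" x] r by (intro mult_right_mono) auto
    also have "\<dots> = real l * (V * r powr real CARD('n))"
      using r by (simp add: V_def powr_realpow power_mult_distrib mult_2[symmetric])
    also have "\<dots> = (real l * r powr d) * (V * r powr (real CARD('n) - d))"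
      using r by (simp add: powr_diff)
    also have "\<dots> \<le> 1 * (V * r powr (real CARD('n) - d))"
      using lx(1) V by (intro mult_right_mono) auto
    also have "\<dots> \<le> V * r powr t"
      using d(3) r V by (auto intro!: mult_left_mono powr_mono')
    finally show ?thesis .
  qed
  then show ?thesis using b(1) by (intro exI[of _ V] exI[of _ "min b 1"]) auto
qed

text \<open>At every scale \<open>r\<close>, of the order of \<open>(1 / r) ^ k\<close> balls of radius comparable to \<open>r\<close> cover \<open>S\<close>; in
other words, the \<open>k\<close>-dimensional Minkowski contents of \<open>S\<close> are bounded. The free factor \<open>L\<close> in the
radius makes this visibly stable under Lipschitz maps, and the centres lie in \<open>S\<close> because such
maps are Lipschitz on \<open>S\<close> only.\<close>

definition covering_exponent :: "nat \<Rightarrow> 'a::metric_space set \<Rightarrow> bool" where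
  "covering_exponent k S \<longleftrightarrow> (\<exists>C\<ge>0. \<exists>L\<ge>0. \<forall>r::real. 0 < r \<longrightarrow> r \<le> 1 \<longrightarrow>
     (\<exists>A. finite A \<and> A \<subseteq> S \<and> real (card A) * r ^ k \<le> C \<and> S \<subseteq> (\<Union>a\<in>A. cball a (L * r))))"

text \<open>Centres outside \<open>S\<close> may be moved into \<open>S\<close> at the cost of doubling the radius.\<close>

lemma covering_exponentI:
  assumes "C \<ge> 0" "L \<ge> 0" and
    ex: "\<And>r. 0 < r \<Longrightarrow> r \<le> 1 \<Longrightarrow> \<exists>A. finite A \<and> real (card A) * r ^ k \<le> C \<and> S \<subseteq> (\<Union>a\<in>A. cball a (L * r))"
  shows "covering_exponent k S"
proof -
  have "\<exists>A. finite A \<and> A \<subseteq> S \<and> real (card A) * r ^ k \<le> C \<and> S \<subseteq> (\<Union>a\<in>A. cball a (2 * L * r))"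
    if r: "0 < r" "r \<le> 1" for r
  proof -
    obtain A where A: "finite A" "real (card A) * r ^ k \<le> C" "S \<subseteq> (\<Union>a\<in>A. cball a (L * r))"
      using ex[OF r] by blast
    define A0 where "A0 = {a \<in> A. S \<inter> cball a (L * r) \<noteq> {}}"
    define f where "f = (\<lambda>a. SOME s. s \<in> S \<inter> cball a (L * r))"
    have f: "f a \<in> S \<inter> cball a (L * r)" if "a \<in> A0" for a
    proof -
      have "\<exists>s. s \<in> S \<inter> cball a (L * r)" using that by (auto simp: A0_def)
      then show ?thesis unfolding f_def by (rule someI_ex)
    qed
    have "card (f ` A0) \<le> card A"
      using card_image_le[of A0 f] card_mono[OF A(1), of A0] A(1) by (auto simp: A0_def)
    then have "real (card (f ` A0)) * r ^ k \<le> real (card A) * r ^ k" using r by (intro mult_right_mono) auto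
    moreover have "S \<subseteq> (\<Union>a\<in>f ` A0. cball a (2 * L * r))"
    proof
      fix s assume s: "s \<in> S"
      then obtain a where a: "a \<in> A" "dist a s \<le> L * r" using A(3) by auto
      then have "a \<in> A0" using s by (auto simp: A0_def)
      moreover have "dist (f a) s \<le> 2 * L * r"
        using f[OF \<open>a \<in> A0\<close>] a(2) dist_triangle[of "f a" s a] by (simp add: dist_commute)
      ultimately show "s \<in> (\<Union>a\<in>f ` A0. cball a (2 * L * r))" by auto
    qed
    moreover have "finite (f ` A0)" using A(1) by (auto simp: A0_def)
    moreover have "f ` A0 \<subseteq> S" using f by blast
    moreover have "real (card (f ` A0)) * r ^ k \<le> C"
      using \<open>real (card (f ` A0)) * r ^ k \<le> real (card A) * r ^ k\<close> A(2) by linarith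
    ultimately show ?thesis by (intro exI[of _ "f ` A0"] conjI)
  qed
  note ex2 = this
  show ?thesis unfolding covering_exponent_def
  proof (rule exI[of _ C], rule conjI[OF assms(1)], rule exI[of _ "2 * L"], intro conjI allI impI)
    show "0 \<le> 2 * L" using assms(2) by simp
  qed (rule ex2)
qed

lemma covering_exponent_subset:
  assumes "covering_exponent k T" "S \<subseteq> T" shows "covering_exponent k S"
proof -
  obtain C L where "C \<ge> 0" "L \<ge> 0" "\<And>r. 0 < r \<Longrightarrow> r \<le> 1 \<Longrightarrow>
     (\<exists>A. finite A \<and> A \<subseteq> T \<and> real (card A) * r ^ k \<le> C \<and> T \<subseteq> (\<Union>a\<in>A. cball a (L * r)))"
    using assms(1) unfolding covering_exponent_def by blast
  note T = this
  show ?thesis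
  proof (rule covering_exponentI[OF T(1,2)])
    fix r :: real assume "0 < r" "r \<le> 1"
    from T(3)[OF this] obtain A where "finite A" "real (card A) * r ^ k \<le> C" "T \<subseteq> (\<Union>a\<in>A. cball a (L * r))"
      by blast
    then show "\<exists>A. finite A \<and> real (card A) * r ^ k \<le> C \<and> S \<subseteq> (\<Union>a\<in>A. cball a (L * r))"
      using assms(2) by (intro exI[of _ A] conjI order_trans[OF assms(2)])
  qed
qed

lemma covering_exponent_Un:
  assumes "covering_exponent k S" "covering_exponent k T" shows "covering_exponent k (S \<union> T)"
proof -
  obtain C L where S: "C \<ge> 0" "L \<ge> 0" "\<And>r. 0 < r \<Longrightarrow> r \<le> 1 \<Longrightarrow>
     (\<exists>A. finite A \<and> A \<subseteq> S \<and> real (card A) * r ^ k \<le> C \<and> S \<subseteq> (\<Union>a\<in>A. cball a (L * r)))"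
    using assms(1) unfolding covering_exponent_def by blast
  obtain D M where T: "D \<ge> 0" "M \<ge> 0" "\<And>r. 0 < r \<Longrightarrow> r \<le> 1 \<Longrightarrow>
     (\<exists>A. finite A \<and> A \<subseteq> T \<and> real (card A) * r ^ k \<le> D \<and> T \<subseteq> (\<Union>a\<in>A. cball a (M * r)))"
    using assms(2) unfolding covering_exponent_def by blast
  show ?thesis
  proof (rule covering_exponentI[of "C + D" "max L M"])
    fix r :: real assume r: "0 < r" "r \<le> 1"
    obtain A where A: "finite A" "real (card A) * r ^ k \<le> C" "S \<subseteq> (\<Union>a\<in>A. cball a (L * r))"
      using S(3)[OF r] by blast
    obtain B where B: "finite B" "real (card B) * r ^ k \<le> D" "T \<subseteq> (\<Union>a\<in>B. cball a (M * r))"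
      using T(3)[OF r] by blast
    have "real (card (A \<union> B)) * r ^ k \<le> (real (card A) + real (card B)) * r ^ k"
      using card_Un_le[of A B] r by (intro mult_right_mono) auto
    then have 1: "real (card (A \<union> B)) * r ^ k \<le> C + D" using A(2) B(2) by (simp add: distrib_right)
    have "L * r \<le> max L M * r" "M * r \<le> max L M * r" using r by (auto intro: mult_right_mono)
    then have cb: "cball a (L * r) \<subseteq> cball a (max L M * r)" "cball a (M * r) \<subseteq> cball a (max L M * r)" for a :: 'a
      by (auto intro: subset_cball)
    have "S \<subseteq> (\<Union>a\<in>A. cball a (max L M * r))"
      by (rule order_trans[OF A(3) UN_mono[OF order_refl cb(1)]])
    moreover have "T \<subseteq> (\<Union>a\<in>B. cball a (max L M * r))"
      by (rule order_trans[OF B(3) UN_mono[OF order_refl cb(2)]])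
    ultimately have "S \<union> T \<subseteq> (\<Union>a\<in>A \<union> B. cball a (max L M * r))"
      unfolding UN_Un by (rule Un_mono)
    then show "\<exists>A. finite A \<and> real (card A) * r ^ k \<le> C + D \<and> S \<union> T \<subseteq> (\<Union>a\<in>A. cball a (max L M * r))"
      using 1 A(1) B(1) by (intro exI[of _ "A \<union> B"]) auto
  qed (use S T in auto)
qed

lemma covering_exponent_UN:
  assumes "finite I" "\<And>i. i \<in> I \<Longrightarrow> covering_exponent k (S i)" shows "covering_exponent k (\<Union>i\<in>I. S i)"
  using assms
proof (induction I rule: finite_induct)
  case empty
  show ?case by (rule covering_exponentI[of 0 0]) auto
next
  case (insert i I)
  then show ?case by (simp add: covering_exponent_Un)
qed

lemma covering_exponent_Lipschitz_image:
  assumes S: "covering_exponent k S" and B: "B \<ge> 0" "\<And>x y. x \<in> S \<Longrightarrow> y \<in> S \<Longrightarrow> dist (f x) (f y) \<le> B * dist x y"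
  shows "covering_exponent k (f ` S)"
proof -
  obtain C L where S: "C \<ge> 0" "L \<ge> 0" "\<And>r. 0 < r \<Longrightarrow> r \<le> 1 \<Longrightarrow>
     (\<exists>A. finite A \<and> A \<subseteq> S \<and> real (card A) * r ^ k \<le> C \<and> S \<subseteq> (\<Union>a\<in>A. cball a (L * r)))"
    using S unfolding covering_exponent_def by blast
  show ?thesis
  proof (rule covering_exponentI[of C "B * L"])
    fix r :: real assume r: "0 < r" "r \<le> 1"
    obtain A where A: "finite A" "A \<subseteq> S" "real (card A) * r ^ k \<le> C" "S \<subseteq> (\<Union>a\<in>A. cball a (L * r))"
      using S(3)[OF r] by blast
    have "real (card (f ` A)) * r ^ k \<le> real (card A) * r ^ k"
      using card_image_le[OF A(1), of f] r by (intro mult_right_mono) auto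
    then have 1: "real (card (f ` A)) * r ^ k \<le> C" using A(3) by simp
    have "f ` S \<subseteq> (\<Union>a\<in>f ` A. cball a (B * L * r))"
    proof clarify
      fix s assume s: "s \<in> S"
      then obtain a where a: "a \<in> A" "dist a s \<le> L * r" using A(4) by auto
      have "dist (f a) (f s) \<le> B * dist a s" using a A(2) s by (intro B) auto
      also have "\<dots> \<le> B * (L * r)" by (intro mult_left_mono a B)
      finally show "f s \<in> (\<Union>a\<in>f ` A. cball a (B * L * r))" using a(1) by (auto simp: mult.assoc)
    qed
    then show "\<exists>A. finite A \<and> real (card A) * r ^ k \<le> C \<and> f ` S \<subseteq> (\<Union>a\<in>A. cball a (B * L * r))"
      using 1 A(1) by (intro exI[of _ "f ` A"]) auto
  qed (use S B in auto)
qed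

text \<open>The centres are the points of the lattice \<open>r * \<int>^k\<close> in a box; rounding the coordinates down moves a
point by at most \<open>r\<close> in each of them.\<close>

lemma covering_exponent_coordinate_plane:
  fixes I :: "'n::finite set"
  assumes R: "R \<ge> 0"
  shows "covering_exponent (card I) (cball 0 R \<inter> {y :: real ^ 'n. \<forall>i. i \<notin> I \<longrightarrow> y $ i = 0})" (is "covering_exponent _ ?S")
proof (rule covering_exponentI[of "(2 * R + 3) ^ card I" "real CARD('n)"])
  fix r :: real assume r: "0 < r" "r \<le> 1"
  define m where "m = \<lceil>R / r\<rceil>"
  have "0 \<le> R / r" using R r by simp
  then have m0: "m \<ge> 0" unfolding m_def by linarith
  define F where "F = (\<lambda>f :: 'n \<Rightarrow> int. (\<chi> i. if i \<in> I then r * of_int (f i) else 0) :: real ^ 'n)"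
  define P where "P = PiE I (\<lambda>_. {-m..m})"
  have P: "finite P" "card P = nat (2 * m + 1) ^ card I"
    by (auto simp: P_def card_PiE intro!: finite_PiE)
  have "real (nat (2 * m + 1)) * r \<le> 2 * R + 3"
  proof -
    have "real_of_int m \<le> R / r + 1" unfolding m_def by linarith
    then have "real_of_int m * r \<le> R + r" using r by (simp add: field_simps)
    then show ?thesis using m0 r by (simp add: algebra_simps)
  qed
  then have "(real (nat (2 * m + 1)) * r) ^ card I \<le> (2 * R + 3) ^ card I"
    using r by (intro power_mono) auto
  moreover have "real (card (F ` P)) * r ^ card I \<le> real (card P) * r ^ card I"
    using card_image_le[OF P(1), of F] r by (intro mult_right_mono) auto
  ultimately have c: "real (card (F ` P)) * r ^ card I \<le> (2 * R + 3) ^ card I"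
    by (simp add: P(2) power_mult_distrib)
  have "?S \<subseteq> (\<Union>a\<in>F ` P. cball a (real CARD('n) * r))"
  proof
    fix y assume y: "y \<in> ?S"
    define f where "f = restrict (\<lambda>i. \<lfloor>y $ i / r\<rfloor>) I"
    have "\<bar>y $ i\<bar> \<le> R" for i using y component_le_norm_cart[of y i] by auto
    then have b: "- (R / r) \<le> y $ i / r" "y $ i / r \<le> R / r" for i
      using r by (auto simp: divide_right_mono abs_le_iff field_simps) (smt (verit, best))
    have "\<lfloor>y $ i / r\<rfloor> \<le> m" "- m \<le> \<lfloor>y $ i / r\<rfloor>" for i
      unfolding m_def using b[of i] by linarith+
    then have fP: "f \<in> P" by (auto simp: f_def P_def)
    have "\<bar>(F f - y) $ i\<bar> \<le> r" for i
    proof (cases "i \<in> I")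
      case True
      have "r * of_int \<lfloor>y $ i / r\<rfloor> \<le> r * (y $ i / r)" "r * (y $ i / r) \<le> r * (of_int \<lfloor>y $ i / r\<rfloor> + 1)"
        using r by (intro mult_left_mono; linarith)+
      then have "r * of_int \<lfloor>y $ i / r\<rfloor> \<le> y $ i" "y $ i \<le> r * of_int \<lfloor>y $ i / r\<rfloor> + r"
        using r by (simp_all add: distrib_left)
      then show ?thesis using True by (simp add: F_def f_def abs_le_iff)
    next
      case False
      then show ?thesis using y r by (simp add: F_def)
    qed
    then have "norm (F f - y) \<le> (\<Sum>i\<in>(UNIV::'n set). r)"
      by (intro order_trans[OF norm_le_l1_cart] sum_mono)
    then have "dist (F f) y \<le> real CARD('n) * r" by (simp add: dist_norm)
    then show "y \<in> (\<Union>a\<in>F ` P. cball a (real CARD('n) * r))" using fP by auto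
  qed
  then show "\<exists>A. finite A \<and> real (card A) * r ^ card I \<le> (2 * R + 3) ^ card I \<and> ?S \<subseteq> (\<Union>a\<in>A. cball a (real CARD('n) * r))"
    using c P(1) by (intro exI[of _ "F ` P"]) auto
qed (use R in auto)

lemma Ck_on_Lipschitz_cball:
  fixes f :: "'a::euclidean_space \<Rightarrow> 'b::real_normed_vector"
  assumes "Ck_on (Suc 0) V f" "cball c \<rho> \<subseteq> V"
  shows "\<exists>B\<ge>0. \<forall>x\<in>cball c \<rho>. \<forall>y\<in>cball c \<rho>. dist (f x) (f y) \<le> B * dist x y"
proof -
  have D: "(f has_derivative frechet_derivative f (at x)) (at x)" if "x \<in> V" for x
    by (rule Ck_on_has_derivative[OF assms(1) that])
  have "\<exists>B\<ge>0. \<forall>x\<in>cball c \<rho>. norm (frechet_derivative f (at x) b) \<le> B" for b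
  proof -
    have "continuous_on (cball c \<rho>) (\<lambda>x. frechet_derivative f (at x) b)"
      using assms by (auto intro: continuous_on_subset)
    then have "bounded ((\<lambda>x. frechet_derivative f (at x) b) ` cball c \<rho>)"
      by (intro compact_imp_bounded compact_continuous_image) auto
    then obtain B where "B > 0" "\<forall>x\<in>cball c \<rho>. norm (frechet_derivative f (at x) b) \<le> B"
      unfolding bounded_pos by auto
    then show ?thesis by (intro exI[of _ B]) auto
  qed
  then obtain B where B: "\<And>b. B b \<ge> 0" "\<And>b x. x \<in> cball c \<rho> \<Longrightarrow> norm (frechet_derivative f (at x) b) \<le> B b"
    by metis
  have "dist (f x) (f y) \<le> (\<Sum>b\<in>Basis. B b) * dist x y" if "x \<in> cball c \<rho>" "y \<in> cball c \<rho>" for x y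
    unfolding dist_norm
  proof (rule differentiable_bound[OF convex_cball _ _ that])
    fix z assume z: "z \<in> cball c \<rho>"
    then have Dz: "(f has_derivative frechet_derivative f (at z)) (at z)" using D assms(2) by blast
    then show "(f has_derivative frechet_derivative f (at z)) (at z within cball c \<rho>)"
      by (rule has_derivative_at_withinI)
    show "onorm (frechet_derivative f (at z)) \<le> (\<Sum>b\<in>Basis. B b)"
      by (rule order_trans[OF onorm_componentwise[OF has_derivative_bounded_linear[OF Dz]] sum_mono[OF B(2)[OF z]]])
  qed
  then show ?thesis using B(1) by (intro exI[of _ "\<Sum>b\<in>Basis. B b"]) (auto intro: sum_nonneg)
qed

text \<open>Locally the manifold is the image of a bounded piece of a coordinate plane under the inverse
\<open>\<Psi>\<close> of a chart, which is Lipschitz on closed balls; compactness reduces the claim to finitely many charts.\<close>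

lemma covering_exponent_closed_manifold:
  fixes M :: "(real ^ 'n::finite) set"
  assumes "smooth_closed_manifold k M"
  shows "covering_exponent k M"
proof -
  have "\<exists>U. open U \<and> z \<in> U \<and> covering_exponent k (M \<inter> U)" if "z \<in> M" for z
  proof -
    obtain U V \<Phi> \<Psi> and I :: "'n set" where c: "open U" "open V" "z \<in> U" "homeomorphism U V \<Phi> \<Psi>"
        "Cinfty_on V (\<Psi> :: real ^ 'n \<Rightarrow> real ^ 'n)" "card I = k"
        "\<Phi> ` (U \<inter> M) = V \<inter> {y. \<forall>i. i \<notin> I \<longrightarrow> y $ i = 0}"
      using assms \<open>z \<in> M\<close> unfolding smooth_closed_manifold_def by blast
    have "\<Phi> z \<in> V" using c(3,4) by (auto simp: homeomorphism_def)
    then obtain \<rho> where \<rho>: "\<rho> > 0" "cball (\<Phi> z) \<rho> \<subseteq> V" using c(2) open_contains_cball by blast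
    have "Ck_on (Suc 0) V \<Psi>" using c(5) unfolding Cinfty_on_def by blast
    from Ck_on_Lipschitz_cball[OF this \<rho>(2)]
    obtain B where B: "B \<ge> 0" "\<And>x y. x \<in> cball (\<Phi> z) \<rho> \<Longrightarrow> y \<in> cball (\<Phi> z) \<rho> \<Longrightarrow> dist (\<Psi> x) (\<Psi> y) \<le> B * dist x y"
      by blast
    define S where "S = cball (\<Phi> z) \<rho> \<inter> {y. \<forall>i. i \<notin> I \<longrightarrow> y $ i = 0}"
    have "cball (\<Phi> z) \<rho> \<subseteq> cball 0 (norm (\<Phi> z) + \<rho>)"
    proof
      fix y assume "y \<in> cball (\<Phi> z) \<rho>"
      then show "y \<in> cball 0 (norm (\<Phi> z) + \<rho>)"
        using norm_triangle_sub[of y "\<Phi> z"] by (simp add: dist_norm norm_minus_commute)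
    qed
    moreover have "covering_exponent (card I) (cball 0 (norm (\<Phi> z) + \<rho>) \<inter> {y :: real ^ 'n. \<forall>i. i \<notin> I \<longrightarrow> y $ i = 0})"
      using \<rho>(1) by (intro covering_exponent_coordinate_plane) auto
    ultimately have "covering_exponent k S"
      unfolding c(6)[symmetric] by (elim covering_exponent_subset) (auto simp: S_def)
    then have 1: "covering_exponent k (\<Psi> ` S)"
      by (rule covering_exponent_Lipschitz_image[OF _ B(1)]) (auto simp: S_def intro: B(2))
    define U' where "U' = U \<inter> \<Phi> -` ball (\<Phi> z) \<rho>"
    have "open U'"
      unfolding U'_def using c(1,4) by (intro continuous_open_preimage) (auto simp: homeomorphism_def)
    moreover have "z \<in> U'" using c(3) \<rho>(1) by (simp add: U'_def)
    moreover have "M \<inter> U' \<subseteq> \<Psi> ` S"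
    proof
      fix x assume x: "x \<in> M \<inter> U'"
      then have "\<Phi> x \<in> S" using c(7) by (auto simp: S_def U'_def)
      moreover have "\<Psi> (\<Phi> x) = x" using x c(4) by (auto simp: U'_def homeomorphism_def)
      ultimately show "x \<in> \<Psi> ` S" by (metis image_eqI)
    qed
    ultimately show ?thesis using covering_exponent_subset[OF 1] by blast
  qed
  then obtain U where U: "\<And>z. z \<in> M \<Longrightarrow> open (U z) \<and> z \<in> U z \<and> covering_exponent k (M \<inter> U z)" by metis
  have "compact M" using assms by (simp add: smooth_closed_manifold_def)
  then obtain T where T: "T \<subseteq> M" "finite T" "M \<subseteq> (\<Union>z\<in>T. U z)"
    by (rule compactE_image[of M M U]) (use U in auto)
  have "covering_exponent k (\<Union>z\<in>T. M \<inter> U z)" using T U by (intro covering_exponent_UN) auto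
  then show ?thesis by (rule covering_exponent_subset) (use T in auto)
qed

text \<open>Unlike in the case of the Minkowski dimension, equality \<open>k = N - t\<close> is allowed here, because the
covering numbers of \<open>Z\<close> are controlled at the exponent \<open>k\<close> itself.\<close>

lemma covering_exponent_nbhd_bound:
  fixes Z :: "(real ^ 'n::finite) set"
  assumes Z: "compact Z" "Z \<noteq> {}" and k: "covering_exponent k Z" "real k \<le> real CARD('n) - t"
  shows "\<exists>C r0. r0 > 0 \<and> (\<forall>r. 0 < r \<longrightarrow> r < r0 \<longrightarrow> measure lborel {x. infdist x Z \<le> r} \<le> C * r powr t)"
proof -
  obtain D L where S: "D \<ge> 0" "L \<ge> 0" "\<And>r. 0 < r \<Longrightarrow> r \<le> 1 \<Longrightarrow>
     (\<exists>A. finite A \<and> A \<subseteq> Z \<and> real (card A) * r ^ k \<le> D \<and> Z \<subseteq> (\<Union>a\<in>A. cball a (L * r)))"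
    using k(1) unfolding covering_exponent_def by blast
  define V where "V = unit_ball_vol (real CARD('n)) * (L + 1) ^ CARD('n)"
  have V: "V \<ge> 0" using S by (simp add: V_def)
  have "measure lborel {x. infdist x Z \<le> r} \<le> D * V * r powr t" if r: "0 < r" "r < 1" for r
  proof -
    obtain A where A: "finite A" "real (card A) * r ^ k \<le> D" "Z \<subseteq> (\<Union>a\<in>A. cball a (L * r))"
      using S(3)[of r] r by auto
    have "measure lborel {x. infdist x Z \<le> r} \<le> real (card A) * (unit_ball_vol (real CARD('n)) * (L * r + r) ^ CARD('n))"
      using measure_nbhd_le_cover[OF Z A(1,3), of r] r S by simp
    also have "\<dots> = real (card A) * (V * r powr real CARD('n))"
      using r by (simp add: V_def powr_realpow power_mult_distrib distrib_right[of L 1 r, symmetric, simplified])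
    also have "\<dots> = (real (card A) * r ^ k) * (V * r powr (real CARD('n) - real k))"
      using r by (simp add: powr_diff powr_realpow)
    also have "\<dots> \<le> D * (V * r powr (real CARD('n) - real k))"
      using A(2) V by (intro mult_right_mono) auto
    also have "\<dots> \<le> D * (V * r powr t)"
      using k(2) r V S by (auto intro!: mult_left_mono powr_mono')
    finally show ?thesis by (simp add: mult.assoc)
  qed
  then show ?thesis by (intro exI[of _ "D * V"] exI[of _ 1]) auto
qed

section \<open>Removability of the singular set\<close>

theorem proposition3p1:
  fixes u :: "real ^ 'n::finite \<Rightarrow> real" and Z :: "(real ^ 'n) set"
    and i\<^sub>1 :: 'n and p :: real
  assumes "CARD('n) \<ge> 5"
    and "p > real CARD('n) / (real CARD('n) - 4)"
    and "compact Z"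
    and "Z \<subset> {x. x $ i\<^sub>1 = 0}"
    and "upper_minkowski_dim Z < ereal (real CARD('n) - 4 * p / (p - 1)) \<or>
         (\<exists>k. smooth_closed_manifold k Z \<and> real k \<le> real CARD('n) - 4 * p / (p - 1))"
    and "punctured_solution p Z u"
    and "\<forall>x\<in>- Z. u x > 0"
  shows "Lp_loc p u \<and> distributional_solution p u"
proof -
  define q where "q = p / (p - 1)"
  have N5: "real CARD('n) \<ge> 5" using assms(1) by simp
  then have "p > 1"
    using assms(2) by (smt (verit) divide_less_eq_1_pos)
  have Nq: "4 * q < real CARD('n)"
  proof -
    have "real CARD('n) < p * (real CARD('n) - 4)" using assms(2) N5 by (simp add: field_simps)
    then show ?thesis using \<open>p > 1\<close> by (simp add: q_def field_simps)
  qed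
  have e: "4 * p / (p - 1) = 4 * q" by (simp add: q_def)
  \<comment> \<open>Enlarging \<open>Z\<close> only weakens the hypotheses on \<open>u\<close>. If \<open>Z\<close> is empty, the distance to it is
    \<open>0\<close> everywhere by convention, and a single point serves instead; it qualifies since \<open>4 * q\<close> is less than the
    dimension of the space, which is what the lower bound on \<open>p\<close> says.\<close>
  have "\<exists>Z'. compact Z' \<and> Z' \<noteq> {} \<and> Z \<subseteq> Z' \<and> (\<exists>C r0. r0 > 0 \<and>
      (\<forall>r. 0 < r \<longrightarrow> r < r0 \<longrightarrow> measure lborel {x. infdist x Z' \<le> r} \<le> C * r powr (4 * q)))"
  proof (cases "Z = {}")
    case True
    have "covering_exponent 0 {0 :: real ^ 'n}"
      by (rule covering_exponentI[of 1 0]) (auto intro!: exI[of _ "{0}"])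
    then show ?thesis
      using covering_exponent_nbhd_bound[of "{0 :: real ^ 'n}" 0 "4 * q"] Nq True by (intro exI[of _ "{0}"]) auto
  next
    case False
    have "\<exists>C r0. r0 > 0 \<and> (\<forall>r. 0 < r \<longrightarrow> r < r0 \<longrightarrow> measure lborel {x. infdist x Z \<le> r} \<le> C * r powr (4 * q))"
      using assms(5) unfolding e
    proof
      assume "upper_minkowski_dim Z < ereal (real CARD('n) - 4 * q)"
      then show ?thesis by (rule minkowski_nbhd_bound[OF assms(3) False])
    next
      assume "\<exists>k. smooth_closed_manifold k Z \<and> real k \<le> real CARD('n) - 4 * q"
      then obtain k where k: "smooth_closed_manifold k Z" "real k \<le> real CARD('n) - 4 * q" by blast
      show ?thesis by (rule covering_exponent_nbhd_bound[OF assms(3) False covering_exponent_closed_manifold[OF k(1)] k(2)])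
    qed
    then show ?thesis using assms(3) False by blast
  qed
  then obtain Z' C r0 where Z': "compact Z'" "Z' \<noteq> {}" "Z \<subseteq> Z'" and r0: "r0 > 0"
    and nb: "\<And>r. 0 < r \<Longrightarrow> r < r0 \<Longrightarrow> measure lborel {x. infdist x Z' \<le> r} \<le> C * r powr (4 * q)"
    by blast
  have "Ck_on 4 (- Z') u"
    by (rule Ck_on_subset[of 4 "- Z"]) (use assms(6) Z'(3) in \<open>auto simp: punctured_solution_def simp del: Ck_on.simps\<close>)
  then have "punctured_solution p Z' u" using assms(6) Z'(3) by (auto simp: punctured_solution_def)
  then interpret punctured_problem u Z' p q C r0
    by unfold_locales (use Z' \<open>p > 1\<close> q_def r0 nb assms(7) in auto)
  show ?thesis by (rule removable_singularity)
qed

end
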